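(* Let $X,Y$ be separable Banach spaces, with $X$ infinite-dimensional in part (i), and let $S\in\mathcal{L}(X,Y)$. Then: (i) $X$ is hereditarily indecomposable if and only if $X$ is HI$_\xi$ for some ordinal $1\le\xi<\omega_1$. (ii) $S$ is strictly singular if and only if $S$ is $\mathcal{S}_\xi$-strictly singular for some ordinal $1\le\xi<\omega_1$.
   Context: $\mathbb{N}=\{1,2,\dots\}$; $\mathcal{L}(X,Y)$ is the space of bounded linear operators from $X$ to $Y$; $\#$ denotes cardinality; $[x_i]_{i\in F}$ is the closed linear span of $\{x_i\}_{i\in F}$. For finite sets $A,B\subseteq\mathbb{N}$, $A<B$ means $\max A<\min B$, and $n\le A$ means $n\le\min A$ (the empty set satisfies all such relations). Schreier families. For families $\mathcal{F},\mathcal{G}$ of finite subsets of $\mathbb{N}$ put $\mathcal{F}[\mathcal{G}]=\{\bigcup_{i=1}^n G_i : n\in\mathbb{N},\ G_1<\dots<G_n,\ G_i\in\mathcal{G}\text{ for } i\le n,\ \{\min G_i\}_{i=1}^n\in\mathcal{F}\}$. Let $\mathcal{S}_0=\{\{n\}:n\in\mathbb{N}\}\cup\{\varnothing\}$, $\mathcal{S}_1=\{F\subseteq\mathbb{N}\text{ finite}: \#F\le\min F\}$ (including $\varnothing$), $\mathcal{S}_{\xi+1}=\mathcal{S}_1[\mathcal{S}_\xi]$, and for a countable limit ordinal $\xi$ fix a sequence of ordinals $\xi_n\nearrow\xi$ and let $\mathcal{S}_\xi=\{F: n\le F\text{ and }F\in\mathcal{S}_{\xi_n}\text{ for some }n\in\mathbb{N}\}$.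 An infinite-dimensional Banach space $X$ is hereditarily indecomposable (HI) if for every two infinite-dimensional subspaces $Y,Z$ of $X$ with $Y\cap Z=\{0\}$ the projection $Y+Z\to Y$, $y+z\mapsto y$, is not bounded. Equivalently, for all infinite-dimensional subspaces $Y,Z$ of $X$ and every $\varepsilon>0$ there is a unit vector $y\in Y$ with $\mathrm{dist}(y,Z)<\varepsilon$. For $1\le\xi<\omega_1$, $X$ is $\mathcal{S}_\xi$-hereditarily indecomposable (HI$_\xi$) if for every $\varepsilon>0$, every infinite-dimensional subspace $Y\subseteq X$ and every basic sequence $(x_n)$ in $X$ there exist $F\in\mathcal{S}_\xi$ and a unit vector $y\in Y$ with $\mathrm{dist}(y,[x_i]_{i\in F})<\varepsilon$. An operator $T\in\mathcal{L}(X,Y)$ is strictly singular if its restriction to any infinite-dimensional subspace is not an isomorphism onto its image. It is $\mathcal{S}_\xi$-strictly singular ($1\le\xi<\omega_1$) if for every $\varepsilon>0$ and every basic sequence $(x_n)$ in $X$ there exist $F\in\mathcal{S}_\xi$ and $z\in[x_i]_{i\in F}\setminus\{0\}$ with $\|Tz\|\le\varepsilon\|z\|$. *)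

theory Defs
  imports "HOL-Analysis.Analysis"
begin

section \<open>The ordinals below \<open>\<omega>\<^sub>1\<close>\<close>

text \<open>The well-order \<open>cardSuc natLeq\<close> is the cardinal successor of \<open>\<aleph>\<^sub>0\<close>, so it has order
  type \<open>\<omega>\<^sub>1\<close> and its points are the countable ordinals.\<close>

typedef omega1 = "Field (cardSuc natLeq)"
proof -
  have "infinite (Field (cardSuc natLeq))"
    using cardSuc_finite[OF natLeq_Card_order] by (simp add: Field_natLeq)
  then have "Field (cardSuc natLeq) \<noteq> {}" by (metis finite.emptyI)
  then show ?thesis by blast
qed

lemma Card_order_cardSuc_natLeq: "Card_order (cardSuc natLeq)"
  by (simp add: cardSuc_Card_order natLeq_Card_order)

lemma Well_order_cardSuc_natLeq: "Well_order (cardSuc natLeq)"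
  using Card_order_cardSuc_natLeq card_order_on_well_order_on by blast

instantiation omega1 :: wellorder
begin

definition less_eq_omega1 :: "omega1 \<Rightarrow> omega1 \<Rightarrow> bool" where
  "x \<le> y \<longleftrightarrow> (Rep_omega1 x, Rep_omega1 y) \<in> cardSuc natLeq"

definition less_omega1 :: "omega1 \<Rightarrow> omega1 \<Rightarrow> bool" where
  "x < y \<longleftrightarrow> x \<le> y \<and> \<not> y \<le> x" for x y :: omega1

instance
proof
  let ?r = "cardSuc natLeq"
  note W = Well_order_cardSuc_natLeq
  have lin: "linear_order_on (Field ?r) ?r" and wf: "wf (?r - Id)"
    using W by (auto simp: well_order_on_def)
  have refl: "refl_on (Field ?r) ?r" and tr: "trans ?r" and an: "antisym ?r"
    and tot: "total_on (Field ?r) ?r"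
    using lin by (auto simp: linear_order_on_def partial_order_on_def preorder_on_def)
  fix x y z :: omega1
  show "x < y \<longleftrightarrow> x \<le> y \<and> \<not> y \<le> x" by (fact less_omega1_def)
  show "x \<le> x" using refl Rep_omega1 by (simp add: less_eq_omega1_def refl_on_def)
  show "x \<le> z" if "x \<le> y" "y \<le> z"
    using that tr unfolding less_eq_omega1_def by (meson transD)
  show as: "x = y" if "x \<le> y" "y \<le> x" for x y :: omega1
    using that an unfolding less_eq_omega1_def by (meson antisymD Rep_omega1_inject)
  show "x \<le> y \<or> y \<le> x"
  proof (cases "x = y")
    case True
    then show ?thesis using refl Rep_omega1 by (simp add: less_eq_omega1_def refl_on_def)
  next
    case False
    then show ?thesis
      using tot Rep_omega1 unfolding less_eq_omega1_def total_on_def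
      by (metis Rep_omega1_inject)
  qed
  have "wf (inv_image (?r - Id) Rep_omega1)" using wf by (rule wf_inv_image)
  moreover have "{(x, y). x < y} \<subseteq> inv_image (?r - Id) Rep_omega1"
    by (auto simp: less_omega1_def less_eq_omega1_def inv_image_def)
  ultimately have "wf {(x :: omega1, y). x < y}" by (rule wf_subset)
  then show "P x" if "\<And>x. (\<And>y. y < x \<Longrightarrow> P y) \<Longrightarrow> P x" for P and x :: omega1
    using that by (induction x rule: wf_induct_rule) blast
qed

end

lemma countable_lessThan_omega1:
  includes cardinal_syntax
  shows "countable {..<\<xi> :: omega1}"
proof -
  let ?r = "cardSuc natLeq"
  have "|underS ?r (Rep_omega1 \<xi>)| <o ?r"
    using Card_order_cardSuc_natLeq Rep_omega1 by (rule card_of_underS)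
  then have "|underS ?r (Rep_omega1 \<xi>)| \<le>o natLeq"
    using cardSuc_ordLeq_ordLess[OF natLeq_Card_order card_of_Card_order] by blast
  then have "|underS ?r (Rep_omega1 \<xi>)| \<le>o |UNIV :: nat set|"
    using card_of_nat ordIso_symmetric ordLeq_ordIso_trans by blast
  then have "countable (underS ?r (Rep_omega1 \<xi>))"
    by (simp add: countable_def flip: card_of_ordLeq)
  moreover have "Rep_omega1 ` {..<\<xi>} \<subseteq> underS ?r (Rep_omega1 \<xi>)"
    by (auto simp: underS_def less_omega1_def less_eq_omega1_def)
  ultimately have "countable (Rep_omega1 ` {..<\<xi>})" by (rule countable_subset[rotated])
  then show ?thesis
    by (rule countable_image_inj_on) (simp add: inj_on_def Rep_omega1_inject)
qed

lemma uncountable_omega1: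
  includes cardinal_syntax
  shows "uncountable (UNIV :: omega1 set)"
proof
  let ?r = "cardSuc natLeq"
  assume "countable (UNIV :: omega1 set)"
  then have "countable (Rep_omega1 ` UNIV)" by (rule countable_image)
  then have "countable (Field ?r)"
    using type_definition.Rep_range[OF type_definition_omega1] by metis
  then have "|Field ?r| \<le>o |UNIV :: nat set|"
    by (simp add: countable_def flip: card_of_ordLeq)
  then have "|Field ?r| \<le>o natLeq"
    using card_of_nat ordLeq_ordIso_trans by blast
  then have "?r \<le>o natLeq"
    using card_of_Field_ordIso[OF Card_order_cardSuc_natLeq] ordIso_ordLeq_trans ordIso_symmetric
    by blast
  then show False
    using cardSuc_greater[OF natLeq_Card_order] not_ordLess_ordLeq by blast
qed

lemma omega1_no_max: "\<exists>\<eta>. \<xi> < (\<eta> :: omega1)"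
proof (rule ccontr)
  assume "\<nexists>\<eta>. \<xi> < \<eta>"
  then have "UNIV = insert \<xi> {..<\<xi>}" by (auto simp: not_less le_less)
  then show False
    using uncountable_omega1 countable_lessThan_omega1 countable_insert by metis
qed

instantiation omega1 :: zero
begin
definition zero_omega1 :: omega1 where "(0 :: omega1) = (LEAST \<xi>. True)"
instance ..
end

definition osuc :: "omega1 \<Rightarrow> omega1" where
  "osuc \<xi> = (LEAST \<eta>. \<xi> < \<eta>)"

instantiation omega1 :: one
begin
definition one_omega1 :: omega1 where "1 = osuc 0"
instance ..
end

definition limit_ordinal :: "omega1 \<Rightarrow> bool" where
  "limit_ordinal \<xi> \<longleftrightarrow> \<xi> \<noteq> 0 \<and> (\<nexists>\<eta>. \<xi> = osuc \<eta>)"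

lemma omega1_zero_le: "0 \<le> (\<xi> :: omega1)"
  unfolding zero_omega1_def by (rule Least_le) simp

lemma less_osuc: "\<xi> < osuc \<xi>"
  unfolding osuc_def using omega1_no_max by (rule LeastI_ex)

lemma osuc_le: "\<xi> < \<eta> \<Longrightarrow> osuc \<xi> \<le> \<eta>"
  unfolding osuc_def by (rule Least_le)

lemma osuc_inject: "osuc \<xi> = osuc \<eta> \<longleftrightarrow> \<xi> = \<eta>"
  by (metis less_osuc osuc_le leD linorder_neqE)

lemma osuc_neq_zero: "osuc \<xi> \<noteq> 0"
  using less_osuc[of \<xi>] omega1_zero_le[of \<xi>] by auto


section \<open>Schreier families\<close>

text \<open>Sets of positive integers are sets of type \<^typ>\<open>nat set\<close> that do not contain \<open>0\<close>.\<close>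

definition set_less :: "nat set \<Rightarrow> nat set \<Rightarrow> bool" where
  "set_less A B \<longleftrightarrow> (\<forall>a\<in>A. \<forall>b\<in>B. a < b)"

text \<open>In \<open>\<F>[\<G>]\<close> the empty set is allowed among the \<open>G\<^sub>i\<close>, is comparable with every set and has no
  minimum; hence the chain condition is required for all pairs \<open>i < j\<close>.\<close>

definition family_comp :: "nat set set \<Rightarrow> nat set set \<Rightarrow> nat set set" where
  "family_comp \<F> \<G> =
    {\<Union> (G ` {1..n}) | (n :: nat) G.
       n \<ge> 1 \<and>
       (\<forall>i\<in>{1..n}. \<forall>j\<in>{1..n}. i < j \<longrightarrow> set_less (G i) (G j)) \<and>
       (\<forall>i\<in>{1..n}. G i \<in> \<G>) \<and>
       {Min (G i) | i. i \<in> {1..n} \<and> G i \<noteq> {}} \<in> \<F>}"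

definition schreier0 :: "nat set set" where
  "schreier0 = {{n} | n. n \<ge> 1} \<union> {{}}"

definition schreier1 :: "nat set set" where
  "schreier1 = {F. finite F \<and> 0 \<notin> F \<and> (F \<noteq> {} \<longrightarrow> card F \<le> Min F)}"

text \<open>The choice, for every countable limit ordinal \<open>\<xi>\<close>, of a sequence \<open>(\<xi>\<^sub>n)\<^sub>n\<^sub>\<ge>\<^sub>1\<close> of ordinals below
  \<open>\<xi>\<close> that increases (not necessarily strictly) to \<open>\<xi>\<close>. Values at non-limit ordinals and at
  \<open>n = 0\<close> play no role.\<close>

definition fundamental_system :: "(omega1 \<Rightarrow> nat \<Rightarrow> omega1) \<Rightarrow> bool" where
  "fundamental_system fs \<longleftrightarrow>
    (\<forall>\<xi>. limit_ordinal \<xi> \<longrightarrow>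
       (\<forall>n\<ge>1. fs \<xi> n < \<xi>) \<and>
       (\<forall>m\<ge>1. \<forall>n\<ge>m. fs \<xi> m \<le> fs \<xi> n) \<and>
       (\<forall>\<eta><\<xi>. \<exists>n\<ge>1. \<eta> < fs \<xi> n))"

text \<open>The restriction \<open>fs \<xi> n < \<xi>\<close> only serves termination: it holds at every limit ordinal if
  \<open>fs\<close> is a fundamental system. The defining equations without it are the
  lemmas \<open>schreier_zero\<close>, \<open>schreier_one\<close>, \<open>schreier_osuc\<close> and \<open>schreier_limit\<close> below.\<close>

function schreier :: "(omega1 \<Rightarrow> nat \<Rightarrow> omega1) \<Rightarrow> omega1 \<Rightarrow> nat set set" where
  "schreier fs \<xi> =
    (if \<xi> = 0 then schreier0
     else if \<exists>\<eta>. \<xi> = osuc \<eta> then family_comp schreier1 (schreier fs (THE \<eta>. \<xi> = osuc \<eta>))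
     else (\<Union>n\<in>{n. n \<ge> 1 \<and> fs \<xi> n < \<xi>}. {F \<in> schreier fs (fs \<xi> n). \<forall>k\<in>F. n \<le> k}))"
  by pat_completeness auto
termination
proof (relation "inv_image {(x, y). x < y} snd")
  show "wf (inv_image {(x :: omega1, y). x < y} snd)" by (simp add: wf)
qed (auto simp: osuc_inject less_osuc)

declare schreier.simps [simp del]

lemma schreier_zero: "schreier fs 0 = schreier0"
  by (simp add: schreier.simps)

lemma schreier_osuc: "schreier fs (osuc \<xi>) = family_comp schreier1 (schreier fs \<xi>)"
  by (subst schreier.simps) (auto simp: osuc_inject osuc_neq_zero)

lemma schreier_limit:
  assumes "fundamental_system fs" "limit_ordinal \<xi>"
  shows "schreier fs \<xi> = {F. \<exists>n\<ge>1. (\<forall>k\<in>F. n \<le> k) \<and> F \<in> schreier fs (fs \<xi> n)}"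
  using assms
  by (subst schreier.simps) (auto simp: fundamental_system_def limit_ordinal_def)

lemma schreier_one: "schreier fs 1 = schreier1"
proof -
  have "F \<in> schreier1" if "F \<in> family_comp schreier1 schreier0" for F
  proof -
    obtain n :: nat and G where F: "F = \<Union> (G ` {1..n})" and G: "\<forall>i\<in>{1..n}. G i \<in> schreier0"
      and M: "{Min (G i) | i. i \<in> {1..n} \<and> G i \<noteq> {}} \<in> schreier1"
      using \<open>F \<in> family_comp schreier1 schreier0\<close> unfolding family_comp_def by blast
    have "G i = {Min (G i)}" if "i \<in> {1..n}" "G i \<noteq> {}" for i
      using G that by (auto simp: schreier0_def)
    then have "F = {Min (G i) | i. i \<in> {1..n} \<and> G i \<noteq> {}}"
      unfolding F by fast
    with M show ?thesis by simp
  qed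
  moreover have "F \<in> family_comp schreier1 schreier0" if F: "F \<in> schreier1" for F
  proof (cases "F = {}")
    case True
    then show ?thesis using F unfolding family_comp_def
      by (auto intro!: exI[of _ "1::nat"] exI[of _ "\<lambda>_. {}"] simp: schreier0_def)
  next
    case False
    have fin: "finite F" and F0: "0 \<notin> F" using F by (auto simp: schreier1_def)
    define l where "l = sorted_list_of_set F"
    have l: "set l = F" "sorted_wrt (<) l" "length l = card F"
      using fin by (simp_all add: l_def strict_sorted_list_of_set)
    define G where "G i = {l ! (i - 1)}" for i
    have n: "card F \<ge> 1" using False fin by (simp add: Suc_leI card_gt_0_iff)
    have U: "(\<lambda>i. l ! (i - 1)) ` {1..card F} = F"
    proof -
      have "(\<lambda>i. i - 1) ` {1..card F} = {..<card F}"
      proof -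
        have "i \<in> (\<lambda>i. i - 1) ` {1..card F}" if "i < card F" for i
          using that by (intro image_eqI[of _ _ "Suc i"]) auto
        then show ?thesis by auto
      qed
      then have "(\<lambda>i. l ! (i - 1)) ` {1..card F} = (!) l ` {..<card F}"
        by (metis image_image)
      then show ?thesis using l nth_image[of "length l" l] by (simp add: lessThan_atLeast0)
    qed
    have "F = \<Union> (G ` {1..card F})" using U by (auto simp: G_def)
    moreover have "\<forall>i\<in>{1..card F}. \<forall>j\<in>{1..card F}. i < j \<longrightarrow> set_less (G i) (G j)"
      using l(2,3) by (auto simp: G_def set_less_def sorted_wrt_iff_nth_less)
    moreover have "\<forall>i\<in>{1..card F}. G i \<in> schreier0"
    proof
      fix i assume "i \<in> {1..card F}"
      then have "l ! (i - 1) \<in> F" using U by blast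
      with F0 have "l ! (i - 1) \<ge> 1" by (metis less_one not_le)
      then show "G i \<in> schreier0" by (auto simp: G_def schreier0_def)
    qed
    moreover have "{Min (G i) | i. i \<in> {1..card F} \<and> G i \<noteq> {}} \<in> schreier1"
    proof -
      have "{Min (G i) | i. i \<in> {1..card F} \<and> G i \<noteq> {}} = (\<lambda>i. l ! (i - 1)) ` {1..card F}"
        by (auto simp: G_def)
      then show ?thesis using U F by simp
    qed
    ultimately show ?thesis using n unfolding family_comp_def by blast
  qed
  ultimately show ?thesis
    by (auto simp: one_omega1_def schreier_osuc schreier_zero)
qed

lemma fundamental_system_exists: "\<exists>fs. fundamental_system fs"
proof -
  define e where "e \<xi> = from_nat_into {..<\<xi>}" for \<xi> :: omega1
  define fs where "fs \<xi> n = Max (e \<xi> ` {..n})" for \<xi> n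
  have "fundamental_system fs"
    unfolding fundamental_system_def
  proof (intro allI impI)
    fix \<xi> assume lim: "limit_ordinal \<xi>"
    then have "0 < \<xi>" using omega1_zero_le[of \<xi>] by (auto simp: limit_ordinal_def le_less)
    then have ne: "{..<\<xi>} \<noteq> {}" by auto
    have e: "range (e \<xi>) = {..<\<xi>}"
      unfolding e_def using ne countable_lessThan_omega1 by (rule range_from_nat_into)
    have "fs \<xi> n < \<xi>" for n
      using e unfolding fs_def by (subst Max_less_iff) auto
    moreover have "fs \<xi> m \<le> fs \<xi> n" if "m \<le> n" for m n
      unfolding fs_def using that by (intro Max_mono) auto
    moreover have "\<exists>n\<ge>1. \<eta> < fs \<xi> n" if "\<eta> < \<xi>" for \<eta>
    proof -
      have "osuc \<eta> < \<xi>"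
        using osuc_le[OF that] lim by (auto simp: limit_ordinal_def le_less)
      then obtain n where "e \<xi> n = osuc \<eta>" using e by (metis imageE lessThan_iff)
      then have "osuc \<eta> \<le> fs \<xi> (Suc n)"
        unfolding fs_def by (metis Max_ge atMost_iff finite_atMost finite_imageI imageI lessI less_imp_le)
      then show ?thesis using less_osuc[of \<eta>] by (intro exI[of _ "Suc n"]) auto
    qed
    ultimately show "(\<forall>n\<ge>1. fs \<xi> n < \<xi>) \<and> (\<forall>m\<ge>1. \<forall>n\<ge>m. fs \<xi> m \<le> fs \<xi> n) \<and>
       (\<forall>\<eta><\<xi>. \<exists>n\<ge>1. \<eta> < fs \<xi> n)" by blast
  qed
  then show ?thesis by blast
qed


section \<open>Banach space notions\<close>

definition closed_span :: "'a::real_normed_vector set \<Rightarrow> 'a set" where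
  "closed_span A = closure (span A)"

text \<open>A subspace is any linear subspace. Demanding that it be closed would not change
  the notions below, since each of the estimates involved passes to closures.\<close>

definition infinite_dimensional_subspace :: "'a::real_normed_vector set \<Rightarrow> bool" where
  "infinite_dimensional_subspace Y \<longleftrightarrow> subspace Y \<and> (\<nexists>B. finite B \<and> span B = Y)"

text \<open>Sequences \<open>(x\<^sub>n)\<^sub>n\<^sub>\<ge>\<^sub>1\<close> are functions on \<^typ>\<open>nat\<close> whose value at \<open>0\<close> is irrelevant. Such a
  sequence is basic if it is a Schauder basis of its closed linear span; \<open>a n\<close> is the coefficient
  of \<open>x\<^sub>n\<^sub>+\<^sub>1\<close>.\<close>

definition basic_sequence :: "(nat \<Rightarrow> 'a::real_normed_vector) \<Rightarrow> bool" where
  "basic_sequence x \<longleftrightarrow>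
    (\<forall>v \<in> closed_span (x ` {1..}). \<exists>!a :: nat \<Rightarrow> real. (\<lambda>n. a n *\<^sub>R x (Suc n)) sums v)"

text \<open>The last line says that the projection \<open>y + z \<mapsto> y\<close> from \<open>Y + Z\<close> to \<open>Y\<close> is unbounded.\<close>

definition hereditarily_indecomposable :: "'a::banach itself \<Rightarrow> bool" where
  "hereditarily_indecomposable _ \<longleftrightarrow>
    infinite_dimensional_subspace (UNIV :: 'a set) \<and>
    (\<forall>Y Z :: 'a set. infinite_dimensional_subspace Y \<longrightarrow> infinite_dimensional_subspace Z \<longrightarrow>
       Y \<inter> Z = {0} \<longrightarrow>
       \<not> (\<exists>K. \<forall>y\<in>Y. \<forall>z\<in>Z. norm y \<le> K * norm (y + z)))"

definition schreier_HI ::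
    "(omega1 \<Rightarrow> nat \<Rightarrow> omega1) \<Rightarrow> omega1 \<Rightarrow> 'a::banach itself \<Rightarrow> bool" where
  "schreier_HI fs \<xi> _ \<longleftrightarrow>
    (\<forall>\<epsilon>>0. \<forall>Y :: 'a set. \<forall>x :: nat \<Rightarrow> 'a.
       infinite_dimensional_subspace Y \<longrightarrow> basic_sequence x \<longrightarrow>
       (\<exists>F \<in> schreier fs \<xi>. \<exists>y\<in>Y. norm y = 1 \<and> infdist y (closed_span (x ` F)) < \<epsilon>))"

definition isomorphism_onto_image_on ::
    "('a::real_normed_vector \<Rightarrow>\<^sub>L 'b::real_normed_vector) \<Rightarrow> 'a set \<Rightarrow> bool" where
  "isomorphism_onto_image_on T Z \<longleftrightarrow>
    inj_on (blinfun_apply T) Z \<and>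
    (\<exists>K. \<forall>w \<in> blinfun_apply T ` Z. norm (inv_into Z (blinfun_apply T) w) \<le> K * norm w)"

definition strictly_singular :: "('a::banach \<Rightarrow>\<^sub>L 'b::banach) \<Rightarrow> bool" where
  "strictly_singular T \<longleftrightarrow>
    (\<forall>Z. infinite_dimensional_subspace Z \<longrightarrow> \<not> isomorphism_onto_image_on T Z)"

definition schreier_strictly_singular ::
    "(omega1 \<Rightarrow> nat \<Rightarrow> omega1) \<Rightarrow> omega1 \<Rightarrow> ('a::banach \<Rightarrow>\<^sub>L 'b::banach) \<Rightarrow> bool" where
  "schreier_strictly_singular fs \<xi> T \<longleftrightarrow>
    (\<forall>\<epsilon>>0. \<forall>x. basic_sequence x \<longrightarrow>
       (\<exists>F \<in> schreier fs \<xi>. \<exists>z \<in> closed_span (x ` F) - {0}.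
          norm (blinfun_apply T z) \<le> \<epsilon> * norm z))"

end

theory Submission
  imports Defs
begin

text \<open>
  The two parts have the same proof; consider the operator \<open>S\<close>. If \<open>S\<close> is bounded below on an
  infinite-dimensional subspace, then that subspace contains a basic sequence (Mazur), and no
  member of a Schreier family can satisfy the condition for small \<open>\<epsilon>\<close>. So being
  \<open>\<S>\<^sub>\<xi>\<close>-strictly singular for one \<open>\<xi>\<close> implies strict singularity. The basic sequence comes from
  \<open>basic_sequence_in_subspace\<close>.

  For the converse, fix \<open>\<epsilon>\<close> and consider the tree of the finite sequences of vectors, each at
  distance at least \<open>1\<close> from the span of its predecessors, on whose span \<open>S\<close> is bounded below
  by \<open>\<epsilon>\<close>. An infinite branch spans a subspace on which \<open>S\<close> is an isomorphism, so if \<open>S\<close> is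
  strictly singular, the tree is well-founded. On the other hand, a basic sequence that refutes
  \<open>\<S>\<^sub>\<xi>\<close>-strict singularity for \<open>\<epsilon>\<close> embeds the family \<open>\<S>\<^sub>\<xi>\<close>, ordered by end-extension, into
  the tree, and this family has rank at least \<open>\<xi>\<close> (\<open>rank_schreier\<close>). If this happens for all
  countable \<open>\<xi>\<close>, then, as reciprocals of integers suffice as values of \<open>\<epsilon>\<close>, it
  happens for one \<open>\<epsilon>\<close> and arbitrarily large \<open>\<xi>\<close>, so a single tree has every countable rank.
  The tree is closed and the space is separable and complete; a closed tree of that kind with
  every countable rank has an infinite branch (\<open>closed_tree_of_rank_omega1_has_branch\<close>), a
  contradiction.

  For hereditary indecomposability the nodes are sequences of pairs. Their components span
  subspaces \<open>Y\<close> and \<open>Z\<close> such that the vectors \<open>y\<close> of \<open>Y\<close> have distance at least \<open>\<epsilon> * norm y\<close>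
  from \<open>Z\<close>, so that a branch gives a bounded projection from \<open>Y + Z\<close> to \<open>Y\<close>.
\<close>


section \<open>Ranks of transition systems\<close>

text \<open>The rank of a state is the supremum of the ranks of its successors, plus one each; a state that
  starts an infinite path has every rank. The predicate says that the rank is at least \<open>\<xi>\<close>, which
  avoids a rank function and its value on the states that are not well-founded.\<close>

inductive rank_ge :: "('v \<Rightarrow> 'v \<Rightarrow> bool) \<Rightarrow> omega1 \<Rightarrow> 'v \<Rightarrow> bool" for step where
  rank_geI: "(\<And>\<eta>. \<eta> < \<xi> \<Longrightarrow> \<exists>w. step v w \<and> rank_ge step \<eta> w) \<Longrightarrow> rank_ge step \<xi> v"

lemma rank_geD: "rank_ge step \<xi> v \<Longrightarrow> \<eta> < \<xi> \<Longrightarrow> \<exists>w. step v w \<and> rank_ge step \<eta> w"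
  by (erule rank_ge.cases) blast

lemma rank_ge_antimono: "rank_ge step \<xi> v \<Longrightarrow> \<eta> \<le> \<xi> \<Longrightarrow> rank_ge step \<eta> v"
  by (rule rank_geI) (meson order.strict_trans2 rank_geD)

text \<open>Lower bounds for ranks are carried from one system to another: if each step of the first can be
  answered by a step of the second, then paths, and hence ranks, can only grow.\<close>

lemma rank_ge_simulation:
  assumes "rank_ge step \<xi> v" and "rel v v'"
    and sim: "\<And>v v' w. rel v v' \<Longrightarrow> step v w \<Longrightarrow> \<exists>w'. step' v' w' \<and> rel w w'"
  shows "rank_ge step' \<xi> v'"
  using assms(1,2)
proof (induction arbitrary: v')
  case (rank_geI \<xi> v)
  show ?case
  proof (rule rank_ge.intros)
    fix \<eta> assume "\<eta> < \<xi>"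
    with rank_geI.IH obtain w where w: "step v w" "\<And>w'. rel w w' \<Longrightarrow> rank_ge step' \<eta> w'"
      by blast
    from sim[OF rank_geI.prems w(1)] w(2)
    show "\<exists>w'. step' v' w' \<and> rank_ge step' \<eta> w'" by blast
  qed
qed

lemma omega1_countable_bounded: "\<exists>b. \<forall>N :: nat. (g N :: omega1) \<le> b"
proof (rule ccontr)
  assume "\<nexists>b. \<forall>N. g N \<le> b"
  then have "UNIV = (\<Union>N. {..<g N})" by (force simp: not_le)
  moreover have "countable (\<Union>N. {..<g N})" by (simp add: countable_lessThan_omega1)
  ultimately show False using uncountable_omega1 by metis
qed

text \<open>If each \<open>N\<close> failed at some ordinal, a common upper bound of these countably many ordinals would
  be an ordinal at which every \<open>N\<close> fails.\<close>

lemma omega1_uniform_choice: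
  fixes P :: "nat \<Rightarrow> omega1 \<Rightarrow> bool"
  assumes ex: "\<And>\<xi>. \<exists>N. P N \<xi>" and anti: "\<And>N \<xi> \<eta>. P N \<xi> \<Longrightarrow> \<eta> \<le> \<xi> \<Longrightarrow> P N \<eta>"
  shows "\<exists>N. \<forall>\<xi>. P N \<xi>"
proof (rule ccontr)
  assume "\<nexists>N. \<forall>\<xi>. P N \<xi>"
  then obtain g where "\<And>N. \<not> P N (g N)" by metis
  moreover obtain b where "\<And>N. g N \<le> b" using omega1_countable_bounded[of g] by blast
  ultimately show False using ex anti by blast
qed

text \<open>If every step lost an element, choosing a lost element at each step would inject
  \<open>\<omega>\<^sub>1\<close> into a countable set.\<close>

lemma antimono_omega1_stabilises:
  fixes U :: "omega1 \<Rightarrow> 'c set"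
  assumes sub: "\<And>\<xi>. U \<xi> \<subseteq> C" and C: "countable C"
    and anti: "\<And>\<xi> \<eta>. \<eta> \<le> \<xi> \<Longrightarrow> U \<xi> \<subseteq> U \<eta>"
  shows "\<exists>\<xi>. U (osuc \<xi>) = U \<xi>"
proof (rule ccontr)
  assume "\<nexists>\<xi>. U (osuc \<xi>) = U \<xi>"
  then have "\<exists>c. c \<in> U \<xi> - U (osuc \<xi>)" for \<xi>
    using anti[of \<xi> "osuc \<xi>"] less_osuc[of \<xi>] by fastforce
  then obtain g where g: "\<And>\<xi>. g \<xi> \<in> U \<xi> - U (osuc \<xi>)" by metis
  have "g \<xi> \<noteq> g \<eta>" if "\<xi> < \<eta>" for \<xi> \<eta>
    using g[of \<xi>] g[of \<eta>] anti[OF osuc_le[OF that]] by auto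
  then have "inj g" by (metis injI neqE)
  moreover have "countable (range g)"
    using C g sub by (meson DiffD1 countable_subset image_subsetI subset_iff)
  ultimately show False using uncountable_omega1 countable_image_inj_on by blast
qed


section \<open>Schreier families have large rank\<close>

text \<open>Elements are added in increasing order, so that a path starting at the empty set enumerates
  the initial segments of a set.\<close>

definition family_step :: "nat set set \<Rightarrow> nat set \<Rightarrow> nat set \<Rightarrow> bool" where
  "family_step \<F> F F' \<longleftrightarrow> (\<exists>n. (\<forall>k\<in>F. k < n) \<and> F' = insert n F \<and> F' \<in> \<F>)"

lemma less_osuc_iff: "\<eta> < osuc \<xi> \<longleftrightarrow> \<eta> \<le> \<xi>"
  by (meson leD leI less_osuc order.strict_trans1 osuc_le)

lemma omega1_cases:
  obtains "\<xi> = 0" | \<eta> where "\<xi> = osuc \<eta>" | "limit_ordinal \<xi>"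
  unfolding limit_ordinal_def by blast

context
  fixes fs assumes fs: "fundamental_system fs"
begin

lemma fs_less: "limit_ordinal \<xi> \<Longrightarrow> n \<ge> 1 \<Longrightarrow> fs \<xi> n < \<xi>"
  using fs by (auto simp: fundamental_system_def)

lemma finite_schreier: "F \<in> schreier fs \<xi> \<Longrightarrow> finite F"
proof (induction \<xi> arbitrary: F rule: less_induct)
  case (less \<xi>)
  show ?case
  proof (cases \<xi> rule: omega1_cases)
    case 1
    with less.prems show ?thesis by (auto simp: schreier_zero schreier0_def)
  next
    case (2 \<eta>)
    have "F \<in> family_comp schreier1 (schreier fs \<eta>)" using less.prems by (simp add: 2 schreier_osuc)
    then obtain n G where F: "F = \<Union> (G ` {1..n::nat})" and G: "\<forall>i\<in>{1..n}. G i \<in> schreier fs \<eta>"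
      unfolding family_comp_def by blast
    have "finite (G i)" if "i \<in> {1..n}" for i
      using less.IH[of \<eta> "G i"] 2 less_osuc[of \<eta>] G that by blast
    then show ?thesis using F by simp
  next
    case 3
    then obtain n where "n \<ge> 1" "F \<in> schreier fs (fs \<xi> n)"
      using less.prems schreier_limit[OF fs 3] by blast
    then show ?thesis using less.IH[OF fs_less[OF 3]] by blast
  qed
qed

lemma singleton_in_schreier: "n \<ge> 1 \<Longrightarrow> {n} \<in> schreier fs \<xi>"
proof (induction \<xi> rule: less_induct)
  case (less \<xi>)
  show ?case
  proof (cases \<xi> rule: omega1_cases)
    case 1
    with less.prems show ?thesis by (auto simp: schreier_zero schreier0_def)
  next
    case (2 \<eta>)
    have "{Min {n} |i. i \<in> {1..1::nat} \<and> {n} \<noteq> {}} = {n}" by auto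
    moreover have "{n} \<in> schreier1" using less.prems by (simp add: schreier1_def)
    ultimately have "{n} \<in> family_comp schreier1 (schreier fs \<eta>)"
      unfolding family_comp_def using less.IH[of \<eta>] less.prems 2 less_osuc[of \<eta>]
      by (intro CollectI exI[of _ "1::nat"] exI[of _ "\<lambda>_. {n}"]) simp
    then show ?thesis by (simp add: 2 schreier_osuc)
  next
    case 3
    then have "{n} \<in> schreier fs (fs \<xi> 1)" using less fs_less by simp
    then show ?thesis using less.prems unfolding schreier_limit[OF fs 3]
      by (intro CollectI exI[of _ 1]) auto
  qed
qed

text \<open>The set is the union of the two blocks \<open>{n}\<close> and \<open>F\<close>, and the two minima form a set in
  \<open>\<S>\<^sub>1\<close> as soon as the smaller one is at least \<open>2\<close>.\<close>

lemma insert_in_schreier_osuc: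
  assumes F: "F \<in> schreier fs \<xi>" and n: "n \<ge> 2" and lt: "\<forall>k\<in>F. n < k"
  shows "insert n F \<in> schreier fs (osuc \<xi>)"
proof (cases "F = {}")
  case True
  then show ?thesis using singleton_in_schreier n by simp
next
  case False
  have fin: "finite F" using F by (rule finite_schreier)
  define G where "G i = (if i = 1 then {n} else F)" for i :: nat
  have I: "{1..2} = {1, 2::nat}" by auto
  have M: "n < Min F" using fin False lt by simp
  have "{Min (G i) |i. i \<in> {1..2} \<and> G i \<noteq> {}} = {n, Min F}"
  proof -
    have "{i \<in> {1..2}. G i \<noteq> {}} = {1, 2}" unfolding I using False by (auto simp: G_def)
    moreover have "{Min (G i) |i. i \<in> {1..2} \<and> G i \<noteq> {}} = (\<lambda>i. Min (G i)) ` {i \<in> {1..2}. G i \<noteq> {}}"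
      by blast
    ultimately show ?thesis by (simp add: G_def)
  qed
  moreover have "{n, Min F} \<in> schreier1"
    using M n by (auto simp: schreier1_def card_insert_if)
  moreover have "insert n F = \<Union> (G ` {1..2})" unfolding I by (auto simp: G_def)
  moreover have "\<forall>i\<in>{1..2}. \<forall>j\<in>{1..2}. i < j \<longrightarrow> set_less (G i) (G j)"
    unfolding I using lt by (auto simp: G_def set_less_def)
  moreover have "\<forall>i\<in>{1..2}. G i \<in> schreier fs \<xi>"
    using F n singleton_in_schreier by (auto simp: G_def)
  ultimately show ?thesis unfolding schreier_osuc family_comp_def
    by (intro CollectI exI[of _ 2] exI[of _ G]) simp
qed

text \<open>The bound \<open>N\<close> makes the induction work. At a successor, one prepends a single point \<open>n\<close> to the
  members of the previous family that lie beyond \<open>n\<close>, which adds one to the rank. At a limit, the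
  \<open>m\<close>-th family of the fundamental sequence contributes only its members all of whose
  elements are at least \<open>m\<close>.\<close>

lemma rank_schreier:
  "rank_ge (family_step {F \<in> schreier fs \<xi>. \<forall>k\<in>F. N \<le> k}) \<xi> {}"
proof (induction \<xi> arbitrary: N rule: less_induct)
  case (less \<xi>)
  show ?case
  proof (cases \<xi> rule: omega1_cases)
    case 1
    show ?thesis
      by (rule rank_geI) (use 1 omega1_zero_le leD in metis)
  next
    case (2 \<eta>)
    let ?G = "{F \<in> schreier fs \<xi>. \<forall>k\<in>F. N \<le> k}"
    define n where "n = N + 2"
    have "rank_ge (family_step ?G) \<eta> {n}"
    proof (rule rank_ge_simulation[where rel = "\<lambda>F F'. F' = insert n F"])
      show "rank_ge (family_step {F \<in> schreier fs \<eta>. \<forall>k\<in>F. Suc n \<le> k}) \<eta> {}"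
        using less.IH[of \<eta> "Suc n"] 2 less_osuc by simp
      show "{n} = insert n {}" by simp
      show "\<exists>w'. family_step ?G v' w' \<and> w' = insert n w"
        if v': "v' = insert n v" and vw: "family_step {F \<in> schreier fs \<eta>. \<forall>k\<in>F. Suc n \<le> k} v w" for v v' w
      proof -
        obtain m where m: "\<forall>k\<in>v. k < m" "w = insert m v" "w \<in> schreier fs \<eta>" "\<forall>k\<in>w. Suc n \<le> k"
          using vw unfolding family_step_def by auto
        have "insert n w \<in> schreier fs \<xi>"
          using insert_in_schreier_osuc[OF m(3), of n] m(4) 2 by (auto simp: n_def Suc_le_eq)
        then have "family_step ?G v' (insert n w)"
          unfolding family_step_def using m v' by (intro exI[of _ m]) (auto simp: n_def)
        then show ?thesis by blast
      qed
    qed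
    then have "rank_ge (family_step ?G) \<zeta> {n}" if "\<zeta> < \<xi>" for \<zeta>
      using that 2 less_osuc_iff rank_ge_antimono by simp
    moreover have "family_step ?G {} {n}"
      unfolding family_step_def using singleton_in_schreier by (auto simp: n_def)
    ultimately show ?thesis by (intro rank_geI exI[of _ "{n}"]) simp
  next
    case 3
    show ?thesis
    proof (rule rank_geI)
      fix \<eta> assume "\<eta> < \<xi>"
      then obtain m where m: "m \<ge> 1" "\<eta> < fs \<xi> m"
        using fs 3 unfolding fundamental_system_def by blast
      let ?H = "{F \<in> schreier fs (fs \<xi> m). \<forall>k\<in>F. max m N \<le> k}"
      let ?G = "{F \<in> schreier fs \<xi>. \<forall>k\<in>F. N \<le> k}"
      have "?H \<subseteq> ?G" using m by (auto simp: schreier_limit[OF fs 3])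
      then have sub: "family_step ?H F F' \<Longrightarrow> family_step ?G F F'" for F F'
        unfolding family_step_def by blast
      have "rank_ge (family_step ?H) (fs \<xi> m) {}"
        by (rule less.IH[OF fs_less[OF 3 m(1)]])
      then have "rank_ge (family_step ?G) (fs \<xi> m) {}"
        by (rule rank_ge_simulation[where rel = "(=)"]) (use sub in blast)+
      then show "\<exists>w. family_step ?G {} w \<and> rank_ge (family_step ?G) \<eta> w"
        using m(2) by (rule rank_geD)
    qed
  qed
qed

end


section \<open>Closed trees on separable complete spaces\<close>

text \<open>A node of length \<open>n\<close> is a pair of \<open>n\<close> and a sequence of which only the first \<open>n\<close> entries count.\<close>

definition tree_step :: "(nat \<Rightarrow> (nat \<Rightarrow> 'e) \<Rightarrow> bool) \<Rightarrow> nat \<times> (nat \<Rightarrow> 'e) \<Rightarrow> nat \<times> (nat \<Rightarrow> 'e) \<Rightarrow> bool" where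
  "tree_step T = (\<lambda>(n, s) (m, t). m = Suc n \<and> (\<forall>i<n. t i = s i) \<and> T m t)"

lemma extensible_list_set_has_branch:
  assumes "[] \<in> U" and ext: "\<And>cs. cs \<in> U \<Longrightarrow> \<exists>c. cs @ [c] \<in> U"
  shows "\<exists>c. \<forall>n. map c [0..<n] \<in> U"
proof -
  have "\<exists>f. \<forall>n. (f n \<in> U \<and> (n = 0 \<longrightarrow> f n = [])) \<and> (\<exists>c. f (Suc n) = f n @ [c])"
    by (rule dependent_nat_choice) (use assms in auto)
  then obtain f where f: "\<And>n. f n \<in> U \<and> (\<exists>c. f (Suc n) = f n @ [c])" and f0: "f 0 = []"
    by blast
  have "f n = map (\<lambda>k. last (f (Suc k))) [0..<n]" for n
  proof (induction n)
    case (Suc n)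
    obtain c where "f (Suc n) = f n @ [c]" using f by blast
    with Suc show ?case by simp
  qed (simp add: f0)
  then show ?thesis using f by metis
qed

text \<open>This is the argument behind the Kunen--Martin theorem, for closed trees. Were
  there only countably many nodes, the sets of nodes of rank at least \<open>\<xi>\<close> would become constant
  at some countable \<open>\<xi>\<close>, and a branch could be read off. In general this is done for codes of
  nodes. A code of a node gives, for each \<open>k\<close> below its length, a list over the dense set that is
  entrywise within \<open>(1/2) ^ k\<close> of its initial segment of length \<open>k + 1\<close>. There are
  only countably many codes, so the set of codes of nodes of rank at least \<open>\<xi>\<close> is the same for \<open>\<xi>\<close> and its successor, for some \<open>\<xi>\<close>.
  Every code in it then has a one-step extension in it, and this yields an infinite sequence of
  codes. The nodes that witness its finite parts may change from one length to the next, but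
  they share codes, so they converge entrywise, and closedness puts the limit into the tree.\<close>

lemma closed_tree_of_rank_omega1_has_branch:
  fixes T :: "nat \<Rightarrow> (nat \<Rightarrow> 'e::complete_space) \<Rightarrow> bool" and D :: "'e set"
  assumes D: "countable D" "closure D = UNIV"
    and closed: "\<And>n f s. (\<And>k. T n (f k)) \<Longrightarrow> (\<And>i. i < n \<Longrightarrow> (\<lambda>k. f k i) \<longlonglongrightarrow> s i) \<Longrightarrow> T n s"
    and init: "\<And>n s. T (Suc n) s \<Longrightarrow> T n s"
    and root: "T 0 s0" and rank: "\<And>\<xi>. rank_ge (tree_step T) \<xi> (0, s0)"
  shows "\<exists>s. \<forall>n. T n s"
proof -
  define codes where "codes cs s \<longleftrightarrow> (\<forall>k<length cs. length (cs ! k) = Suc k \<and>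
      (\<forall>i\<le>k. dist (cs ! k ! i) (s i) < (1/2) ^ k))" for cs :: "'e list list" and s :: "nat \<Rightarrow> 'e"
  define U where "U \<xi> = {cs \<in> lists (lists D). \<exists>s. T (length cs) s \<and> codes cs s \<and>
      rank_ge (tree_step T) \<xi> (length cs, s)}" for \<xi>
  have "\<exists>\<xi>. U (osuc \<xi>) = U \<xi>"
  proof (rule antimono_omega1_stabilises)
    show "countable (lists (lists D))" using D(1) by (intro countable_lists)
    show "U \<xi> \<subseteq> lists (lists D)" for \<xi> by (auto simp: U_def)
    show "U \<xi> \<subseteq> U \<eta>" if "\<eta> \<le> \<xi>" for \<xi> \<eta>
      unfolding U_def by (auto intro: rank_ge_antimono[OF _ that])
  qed
  then obtain \<xi> where \<xi>: "U (osuc \<xi>) = U \<xi>" ..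
  have "\<exists>c. \<forall>n. map c [0..<n] \<in> U \<xi>"
  proof (rule extensible_list_set_has_branch)
    show "[] \<in> U \<xi>" unfolding U_def codes_def using root rank by auto
    fix cs assume "cs \<in> U \<xi>"
    then obtain s where cs: "cs \<in> lists (lists D)" and s: "codes cs s"
        "rank_ge (tree_step T) (osuc \<xi>) (length cs, s)"
      unfolding \<xi>[symmetric] unfolding U_def by blast
    obtain t where t: "\<forall>i<length cs. t i = s i" "T (Suc (length cs)) t"
        "rank_ge (tree_step T) \<xi> (Suc (length cs), t)"
      using rank_geD[OF s(2) less_osuc] by (auto simp: tree_step_def)
    have "\<exists>d\<in>D. dist d (t i) < (1/2) ^ length cs" for i
      using D(2) by (metis UNIV_I closure_approachable half_gt_zero_iff zero_less_one zero_less_power)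
    then obtain d where d: "\<And>i. d i \<in> D" "\<And>i. dist (d i) (t i) < (1/2) ^ length cs" by metis
    let ?c = "map d [0..<Suc (length cs)]"
    have "codes (cs @ [?c]) t"
      unfolding codes_def
    proof (intro allI impI conjI)
      fix k assume k: "k < length (cs @ [?c])"
      show "length ((cs @ [?c]) ! k) = Suc k"
        using s(1) k by (cases "k = length cs") (auto simp: codes_def nth_append)
      fix i assume i: "i \<le> k"
      show "dist ((cs @ [?c]) ! k ! i) (t i) < (1/2) ^ k"
      proof (cases "k = length cs")
        case True
        then show ?thesis using d(2)[of i] i
          by (simp add: nth_append del: upt_Suc)
      next
        case False
        then have "k < length cs" using k by simp
        then show ?thesis using s(1) i t(1) by (auto simp: codes_def nth_append)
      qed
    qed
    moreover have "cs @ [?c] \<in> lists (lists D)" using cs d(1) by (auto simp: in_lists_conv_set)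
    ultimately show "\<exists>c. cs @ [c] \<in> U \<xi>"
      using t by (intro exI[of _ ?c]) (auto simp: U_def)
  qed
  then obtain c where c: "\<And>n. map c [0..<n] \<in> U \<xi>" by blast
  have "\<exists>s. T n s \<and> (\<forall>k<n. \<forall>i\<le>k. dist (c k ! i) (s i) < (1/2) ^ k)" for n
    using c[of n] unfolding U_def codes_def by auto
  then obtain s where s: "\<And>n. T n (s n)"
      "\<And>n k i. k < n \<Longrightarrow> i \<le> k \<Longrightarrow> dist (c k ! i) (s n i) < (1/2) ^ k" by metis
  have "Cauchy (\<lambda>n. s n i)" for i
  proof (rule metric_CauchyI)
    fix e :: real assume "e > 0"
    then obtain k0 where k0: "(1/2) ^ k0 < e / 2" using real_arch_pow_inv[of "e/2" "1/2"] by auto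
    define k where "k = max i k0"
    have "(1/2 :: real) ^ k \<le> (1/2) ^ k0" by (rule power_decreasing) (auto simp: k_def)
    then have k: "(1/2) ^ k < e / 2" using k0 by linarith
    have "dist (s m i) (s n i) < e" if "m \<ge> Suc k" "n \<ge> Suc k" for m n
    proof -
      have "dist (c k ! i) (s m i) < (1/2) ^ k" "dist (c k ! i) (s n i) < (1/2) ^ k"
        using that by (auto intro!: s(2) simp: k_def)
      then show ?thesis using k dist_triangle3[of "s m i" "s n i" "c k ! i"] by linarith
    qed
    then show "\<exists>M. \<forall>m\<ge>M. \<forall>n\<ge>M. dist (s m i) (s n i) < e" by blast
  qed
  \<comment> \<open>Completeness turns the witnessing nodes into a single limit sequence.\<close>
  then have "\<exists>l. (\<lambda>n. s n i) \<longlonglongrightarrow> l" for i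
    using Cauchy_convergent convergent_def by blast
  then obtain t where t: "\<And>i. (\<lambda>n. s n i) \<longlonglongrightarrow> t i" by metis
  have T_le: "T m u" if "m \<le> n" "T n u" for m n u
    using that by (induction rule: dec_induct) (auto intro: init)
  have "T m t" for m
  proof (rule closed)
    show "T m (s (k + m))" for k using T_le[OF _ s(1)] by simp
    show "(\<lambda>k. s (k + m) i) \<longlonglongrightarrow> t i" for i
      using t by (rule LIMSEQ_ignore_initial_segment)
  qed
  then show ?thesis by blast
qed


section \<open>Finite-dimensional subspaces\<close>

lemma span_image_finite_iff:
  fixes x :: "'i \<Rightarrow> 'a::real_vector"
  assumes "finite F"
  shows "v \<in> span (x ` F) \<longleftrightarrow> (\<exists>a. v = (\<Sum>i\<in>F. a i *\<^sub>R x i))"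
proof
  show "\<exists>a. v = (\<Sum>i\<in>F. a i *\<^sub>R x i)" if "v \<in> span (x ` F)"
    using assms that
  proof (induction arbitrary: v)
    case (insert j F)
    from insert.prems obtain k where "v - k *\<^sub>R x j \<in> span (x ` F)"
      by (auto simp: span_insert)
    then obtain a where a: "v - k *\<^sub>R x j = (\<Sum>i\<in>F. a i *\<^sub>R x i)" using insert.IH by blast
    have "(\<Sum>i\<in>F. (a(j := k)) i *\<^sub>R x i) = (\<Sum>i\<in>F. a i *\<^sub>R x i)"
      using insert.hyps by (intro sum.cong) auto
    then have "v = (\<Sum>i\<in>insert j F. (a(j := k)) i *\<^sub>R x i)"
      using a insert.hyps by (simp add: algebra_simps)
    then show ?case by blast
  qed simp
  show "v \<in> span (x ` F)" if ex: "\<exists>a. v = (\<Sum>i\<in>F. a i *\<^sub>R x i)"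
  proof -
    obtain a where "v = (\<Sum>i\<in>F. a i *\<^sub>R x i)" using ex by blast
    moreover have "(\<Sum>i\<in>F. a i *\<^sub>R x i) \<in> span (x ` F)"
      by (intro span_sum span_scale span_base imageI)
    ultimately show ?thesis by simp
  qed
qed

lemma span_range_nat: "v \<in> span (range s) \<longleftrightarrow> (\<exists>k::nat. v \<in> span (s ` {..<k}))"
proof
  assume "v \<in> span (range s)"
  then obtain t r where t: "finite t" "t \<subseteq> range s" "v = (\<Sum>a\<in>t. r a *\<^sub>R a)"
    unfolding span_explicit by blast
  obtain I where I: "finite I" "t = s ` I" using t(1,2) by (metis finite_subset_image)
  obtain k where "I \<subseteq> {..<k}" using I(1) finite_nat_bounded by blast
  then have "t \<subseteq> s ` {..<k}" using I by blast
  moreover have "v \<in> span t" unfolding t(3) by (intro span_sum span_scale span_base)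
  ultimately show "\<exists>k. v \<in> span (s ` {..<k})" using span_mono by blast
next
  show "\<exists>k. v \<in> span (s ` {..<k}) \<Longrightarrow> v \<in> span (range s)"
    by (meson image_mono span_mono subsetD subset_UNIV)
qed

lemma closed_if_compact_Int_cball:
  fixes V :: "'a::real_normed_vector set"
  assumes "\<And>r. compact (V \<inter> cball 0 r)"
  shows "closed V"
  unfolding closed_sequential_limits
proof (intro allI impI)
  fix f l assume f: "(\<forall>n. f n \<in> V) \<and> f \<longlonglongrightarrow> l"
  then have "bounded (range f)" using convergent_imp_bounded by blast
  then obtain r where "\<And>n. norm (f n) \<le> r" by (auto simp: bounded_iff)
  with f have "\<forall>n. f n \<in> V \<inter> cball 0 r" by auto
  then show "l \<in> V" using f compact_imp_closed[OF assms, of r] closed_sequentially by blast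
qed

text \<open>By induction on the spanning set: if \<open>b\<close> has distance \<open>d > 0\<close> from the closed subspace
  \<open>span B\<close>, then the coefficient of \<open>b\<close> in a vector of norm at most \<open>r\<close> is at most \<open>r / d\<close>, and the
  ball lies in a continuous image of a product of two compact sets.\<close>

lemma compact_span_Int_cball:
  fixes B :: "'a::real_normed_vector set"
  assumes "finite B"
  shows "compact (span B \<inter> cball 0 r)"
  using assms
proof (induction arbitrary: r)
  case empty
  show ?case by (simp add: finite_imp_compact)
next
  case (insert b B)
  show ?case
  proof (cases "b \<in> span B")
    case True
    then show ?thesis using insert.IH by (simp add: span_redundant)
  next
    case False
    have cl: "closed (span B)" using insert.IH by (rule closed_if_compact_Int_cball)
    define d where "d = infdist b (span B)"
    have d: "d > 0" unfolding d_def 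
      by (rule infdist_pos_not_in_closed[OF cl _ False]) (metis empty_iff span_zero)
    define R where "R = r + r / d * norm b"
    let ?K = "(\<lambda>p. fst p *\<^sub>R b + snd p) ` ({- (r/d)..r/d} \<times> (span B \<inter> cball 0 R))"
    have K: "compact ?K"
      by (intro compact_continuous_image compact_Times insert.IH continuous_intros) auto
    have "span (insert b B) \<inter> cball 0 r = ?K \<inter> cball 0 r"
    proof (intro equalityI subsetI)
      fix v assume v: "v \<in> span (insert b B) \<inter> cball 0 r"
      then obtain k where k: "v - k *\<^sub>R b \<in> span B" by (auto simp: span_insert)
      define e where "e = v - k *\<^sub>R b"
      have veq: "v = k *\<^sub>R b + e" by (simp add: e_def)
      have "\<bar>k\<bar> * d \<le> norm v"
      proof (cases "k = 0")
        case False
        have "- (1/k) *\<^sub>R e \<in> span B" using k unfolding e_def by (rule span_scale)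
        then have "d \<le> dist b (- (1/k) *\<^sub>R e)" unfolding d_def by (rule infdist_le)
        then have "\<bar>k\<bar> * d \<le> \<bar>k\<bar> * norm (b + (1/k) *\<^sub>R e)"
          by (intro mult_left_mono) (auto simp: dist_norm)
        also have "\<dots> = norm (k *\<^sub>R (b + (1/k) *\<^sub>R e))" by simp
        also have "k *\<^sub>R (b + (1/k) *\<^sub>R e) = v" using False by (simp add: veq scaleR_add_right)
        finally show ?thesis .
      qed simp
      moreover have nv: "norm v \<le> r" using v by simp
      ultimately have kd: "\<bar>k\<bar> \<le> r / d" using d by (simp add: field_simps)
      have "norm e \<le> norm v + \<bar>k\<bar> * norm b"
        unfolding e_def using norm_triangle_ineq4[of v "k *\<^sub>R b"] by simp
      also have "\<dots> \<le> R" unfolding R_def using nv kd by (intro add_mono mult_right_mono) auto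
      finally have "(k, e) \<in> {- (r/d)..r/d} \<times> (span B \<inter> cball 0 R)"
        using k kd by (auto simp: e_def abs_le_iff)
      then have "v \<in> ?K" using veq by (intro image_eqI[of _ _ "(k, e)"]) auto
      then show "v \<in> ?K \<inter> cball 0 r" using v by blast
    next
      fix v assume v: "v \<in> ?K \<inter> cball 0 r"
      then obtain k e where "v = k *\<^sub>R b + e" "e \<in> span B" by auto
      then have "v - k *\<^sub>R b \<in> span B" by simp
      then have "v \<in> span (insert b B)" by (auto simp: span_insert)
      then show "v \<in> span (insert b B) \<inter> cball 0 r" using v by blast
    qed
    then show ?thesis using compact_Int_closed[OF K closed_cball] by simp
  qed
qed

lemma closed_span_finite:
  fixes B :: "'a::real_normed_vector set"
  shows "finite B \<Longrightarrow> closed (span B)"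
  by (intro closed_if_compact_Int_cball compact_span_Int_cball)

text \<open>The distance of \<open>v\<close> from the closed subspace \<open>span B\<close> is positive, and scaling makes it \<open>1\<close>.\<close>

lemma scale_away_from_span:
  fixes v :: "'a::real_normed_vector"
  assumes "finite B" "v \<notin> span B"
  obtains c where "c \<noteq> 0" "\<And>w. w \<in> span B \<Longrightarrow> 1 \<le> norm (c *\<^sub>R v - w)"
proof -
  define d where "d = infdist v (span B)"
  have d: "d > 0" unfolding d_def 
    by (rule infdist_pos_not_in_closed[OF closed_span_finite[OF assms(1)] _ assms(2)])
      (metis empty_iff span_zero)
  have "1 \<le> norm ((1/d) *\<^sub>R v - w)" if "w \<in> span B" for w
  proof -
    have "d \<le> dist v (d *\<^sub>R w)" unfolding d_def by (intro infdist_le span_scale that)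
    also have "v - d *\<^sub>R w = d *\<^sub>R ((1/d) *\<^sub>R v - w)" using d by (simp add: scaleR_diff_right)
    then have "dist v (d *\<^sub>R w) = d * norm ((1/d) *\<^sub>R v - w)" using d by (simp add: dist_norm)
    finally show ?thesis using d by simp
  qed
  then show ?thesis using that[of "1/d"] d by auto
qed


section \<open>Basic sequences in infinite-dimensional subspaces\<close>

text \<open>This is the Hahn--Banach theorem for a functional that norms \<open>e\<close>, with the functional replaced
  by its kernel \<open>H\<close>. A maximal subspace all of whose vectors are orthogonal to \<open>e\<close> in the sense
  of Birkhoff is a hyperplane, because it can be enlarged by \<open>v - c e\<close> for a suitable \<open>c\<close>: as in the
  classical one-step extension, \<open>c\<close> has to lie between a supremum and an infimum.\<close>

lemma birkhoff_orthogonal_hyperplane: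
  fixes e :: "'a::real_normed_vector"
  assumes e: "e \<noteq> 0"
  obtains H where "subspace H" "\<And>h. h \<in> H \<Longrightarrow> norm e \<le> norm (e + h)" "\<And>v. \<exists>c. v - c *\<^sub>R e \<in> H"
proof -
  define A where "A = {H. subspace H \<and> (\<forall>h\<in>H. norm e \<le> norm (e + h))}"
  have "\<exists>M\<in>A. \<forall>X\<in>A. M \<subseteq> X \<longrightarrow> X = M"
  proof (rule subset_Zorn_nonempty)
    have "{0} \<in> A" by (auto simp: A_def)
    then show "A \<noteq> {}" by blast
    fix \<C> assume ne: "\<C> \<noteq> {}" and ch: "subset.chain A \<C>"
    have sub: "\<And>H. H \<in> \<C> \<Longrightarrow> subspace H \<and> (\<forall>h\<in>H. norm e \<le> norm (e + h))"
      using ch by (auto simp: subset.chain_def A_def)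
    have "subspace (\<Union>\<C>)"
      unfolding subspace_def
    proof (intro conjI ballI allI)
      show "0 \<in> \<Union>\<C>" using ne sub subspace_0 by fastforce
      show "c *\<^sub>R x \<in> \<Union>\<C>" if "x \<in> \<Union>\<C>" for c x using that sub subspace_scale by blast
      fix x y assume "x \<in> \<Union>\<C>" "y \<in> \<Union>\<C>"
      then obtain H K where HK: "H \<in> \<C>" "K \<in> \<C>" "x \<in> H" "y \<in> K" by blast
      then have "H \<subseteq> K \<or> K \<subseteq> H" using ch by (auto simp: subset.chain_def)
      then show "x + y \<in> \<Union>\<C>" using HK sub subspace_add by (metis UnionI subsetD)
    qed
    then show "\<Union>\<C> \<in> A" using sub by (auto simp: A_def)
  qed
  then obtain H where H: "H \<in> A" and max: "\<And>X. X \<in> A \<Longrightarrow> H \<subseteq> X \<Longrightarrow> X = H" by blast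
  have sH: "subspace H" and oH: "\<And>h. h \<in> H \<Longrightarrow> norm e \<le> norm (e + h)"
    using H by (auto simp: A_def)
  have low: "s * norm e \<le> norm (s *\<^sub>R e + h)" if "h \<in> H" for s h
  proof (cases "s > 0")
    case True
    have "norm e \<le> norm (e + (1/s) *\<^sub>R h)" using oH sH that subspace_scale by blast
    then have "s * norm e \<le> norm (s *\<^sub>R (e + (1/s) *\<^sub>R h))" using True by simp
    also have "s *\<^sub>R (e + (1/s) *\<^sub>R h) = s *\<^sub>R e + h" using True by (simp add: scaleR_add_right)
    finally show ?thesis .
  next
    case False
    then have "s * norm e \<le> 0" by (simp add: mult_nonpos_nonneg)
    then show ?thesis using norm_ge_zero order_trans by blast
  qed
  have "\<exists>c. v - c *\<^sub>R e \<in> H" for v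
  proof -
    \<comment> \<open>The number \<open>c * norm e\<close> is the value at \<open>v\<close> of the extended functional; \<open>L\<close> collects the lower bounds imposed on it.\<close>
    define L where "L = {s * norm e - norm (s *\<^sub>R e + h - v) | s h. h \<in> H}"
    have key: "s * norm e - norm (s *\<^sub>R e + h - v) \<le> norm (s' *\<^sub>R e + h' + v) - s' * norm e"
      if "h \<in> H" "h' \<in> H" for s s' h h'
    proof -
      have "(s + s') * norm e \<le> norm ((s + s') *\<^sub>R e + (h + h'))"
        using that sH by (intro low subspace_add)
      also have "(s + s') *\<^sub>R e + (h + h') = (s *\<^sub>R e + h - v) + (s' *\<^sub>R e + h' + v)"
        by (simp add: scaleR_add_left)
      also have "norm \<dots> \<le> norm (s *\<^sub>R e + h - v) + norm (s' *\<^sub>R e + h' + v)"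
        by (rule norm_triangle_ineq)
      finally show ?thesis by (simp add: distrib_right)
    qed
    have H0: "0 \<in> H" using sH by (rule subspace_0)
    then have Lne: "L \<noteq> {}" unfolding L_def by blast
    define c where "c = Sup L / norm e"
    have cS: "c * norm e = Sup L" using e by (simp add: c_def)
    have up: "c * norm e \<le> norm (s *\<^sub>R e + h + v) - s * norm e" if "h \<in> H" for s h
      unfolding cS using Lne key that by (intro cSup_least) (auto simp: L_def)
    have "bdd_above L" using key H0 by (intro bdd_aboveI) (auto simp: L_def)
    then have lo: "s * norm e - norm (s *\<^sub>R e + h - v) \<le> c * norm e" if "h \<in> H" for s h
      unfolding cS using that by (intro cSup_upper) (auto simp: L_def)
    let ?w = "v - c *\<^sub>R e"
    have "span (insert ?w H) \<in> A"
      unfolding A_def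
    proof (intro CollectI conjI ballI)
      fix x assume "x \<in> span (insert ?w H)"
      then obtain t where "x - t *\<^sub>R ?w \<in> span H" by (auto simp: span_insert)
      then have hH: "x - t *\<^sub>R ?w \<in> H" using sH by (simp add: span_eq_iff[THEN iffD2])
      define h where "h = x - t *\<^sub>R ?w"
      have x: "x = h + t *\<^sub>R ?w" by (simp add: h_def)
      consider "t = 0" | "t > 0" | "t < 0" by linarith
      then show "norm e \<le> norm (e + x)"
      proof cases
        case 1
        then show ?thesis using oH[OF hH] by simp
      next
        case 2
        define s where "s = (1 - t * c) / t"
        have ts: "t * s = 1 - t * c" using 2 by (simp add: s_def)
        have "(1/t) *\<^sub>R h \<in> H" using hH sH by (simp add: h_def subspace_scale)
        then have "c * norm e \<le> norm (s *\<^sub>R e + (1/t) *\<^sub>R h + v) - s * norm e" by (rule up)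
        then have "t * (c * norm e + s * norm e) \<le> t * norm (s *\<^sub>R e + (1/t) *\<^sub>R h + v)"
          using 2 by (intro mult_left_mono) auto
        also have "t * (c * norm e + s * norm e) = (t * c + t * s) * norm e"
          by (simp add: algebra_simps)
        also have "\<dots> = norm e" by (simp add: ts)
        also have "t * norm (s *\<^sub>R e + (1/t) *\<^sub>R h + v) = norm (t *\<^sub>R (s *\<^sub>R e + (1/t) *\<^sub>R h + v))"
          using 2 by simp
        also have "t *\<^sub>R (s *\<^sub>R e + (1/t) *\<^sub>R h + v) = (t * s) *\<^sub>R e + h + t *\<^sub>R v"
          using 2 by (simp add: scaleR_add_right)
        also have "\<dots> = e + x" unfolding ts x by (simp add: algebra_simps)
        finally show ?thesis .
      next
        case 3
        define r where "r = - t"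
        have r: "r > 0" "t = - r" using 3 by (auto simp: r_def)
        define s where "s = (1 + r * c) / r"
        have rs: "r * s = 1 + r * c" using r by (simp add: s_def)
        have "(1/r) *\<^sub>R h \<in> H" using hH sH by (simp add: h_def subspace_scale)
        then have "s * norm e - norm (s *\<^sub>R e + (1/r) *\<^sub>R h - v) \<le> c * norm e" by (rule lo)
        then have "r * (s * norm e - c * norm e) \<le> r * norm (s *\<^sub>R e + (1/r) *\<^sub>R h - v)"
          using r by (intro mult_left_mono) auto
        also have "r * (s * norm e - c * norm e) = (r * s - r * c) * norm e"
          by (simp add: algebra_simps)
        also have "\<dots> = norm e" by (simp add: rs)
        also have "r * norm (s *\<^sub>R e + (1/r) *\<^sub>R h - v) = norm (r *\<^sub>R (s *\<^sub>R e + (1/r) *\<^sub>R h - v))"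
          using r by simp
        also have "r *\<^sub>R (s *\<^sub>R e + (1/r) *\<^sub>R h - v) = (r * s) *\<^sub>R e + h - r *\<^sub>R v"
          using r by (simp add: scaleR_add_right scaleR_diff_right)
        also have "\<dots> = e + x" unfolding rs x r(2) by (simp add: algebra_simps)
        finally show ?thesis .
      qed
    qed simp
    moreover have "H \<subseteq> span (insert ?w H)" by (meson insertI2 span_base subsetI)
    ultimately have "span (insert ?w H) = H" by (rule max)
    then show ?thesis using span_base[of ?w "insert ?w H"] by auto
  qed
  with sH oH that show ?thesis by blast
qed

text \<open>One vector of \<open>Z\<close> outside \<open>H\<close>, together with \<open>Z \<inter> H\<close>, spans \<open>Z\<close>.\<close>

lemma infinite_dimensional_Int_hyperplane:
  assumes Z: "infinite_dimensional_subspace Z" and H: "subspace H" "\<And>v. \<exists>c. v - c *\<^sub>R e \<in> H"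
  shows "infinite_dimensional_subspace (Z \<inter> H)"
  unfolding infinite_dimensional_subspace_def
proof (intro conjI notI)
  have sZ: "subspace Z" using Z by (simp add: infinite_dimensional_subspace_def)
  show "subspace (Z \<inter> H)" using sZ H(1) by (rule subspace_inter)
  assume "\<exists>B. finite B \<and> span B = Z \<inter> H"
  then obtain B where B: "finite B" "span B = Z \<inter> H" by blast
  have notH: "\<not> Z \<subseteq> H" using B Z unfolding infinite_dimensional_subspace_def by (metis inf.absorb1)
  then obtain z0 where z0: "z0 \<in> Z" "z0 \<notin> H" by blast
  obtain c0 where c0: "z0 - c0 *\<^sub>R e \<in> H" using H(2) by blast
  have c0nz: "c0 \<noteq> 0" using c0 z0 by auto
  have "span (insert z0 B) = Z"
  proof (intro equalityI subsetI)
    have "B \<subseteq> Z" using B(2) span_superset by blast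
    then show "x \<in> Z" if "x \<in> span (insert z0 B)" for x
      using that span_minimal[of "insert z0 B" Z] z0 sZ by blast
    fix z assume z: "z \<in> Z"
    obtain c where c: "z - c *\<^sub>R e \<in> H" using H(2) by blast
    have "(z - c *\<^sub>R e) - (c / c0) *\<^sub>R (z0 - c0 *\<^sub>R e) \<in> H"
      by (rule subspace_diff[OF H(1) c subspace_scale[OF H(1) c0]])
    also have "(z - c *\<^sub>R e) - (c / c0) *\<^sub>R (z0 - c0 *\<^sub>R e) = z - (c / c0) *\<^sub>R z0"
      using c0nz by (simp add: algebra_simps)
    finally have "z - (c / c0) *\<^sub>R z0 \<in> span B"
      unfolding B(2) using z z0 sZ by (auto intro: subspace_diff subspace_scale)
    then show "z \<in> span (insert z0 B)" by (auto simp: span_insert)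
  qed
  then show False using Z B(1) unfolding infinite_dimensional_subspace_def by blast
qed

lemma infinite_dimensional_birkhoff_orthogonal:
  assumes "finite N" "0 \<notin> N" "infinite_dimensional_subspace Z"
  shows "\<exists>Z'\<subseteq>Z. infinite_dimensional_subspace Z' \<and> (\<forall>e\<in>N. \<forall>h\<in>Z'. norm e \<le> norm (e + h))"
  using assms
proof (induction arbitrary: Z)
  case (insert e N)
  then obtain Z' where Z': "Z' \<subseteq> Z" "infinite_dimensional_subspace Z'"
    "\<forall>e\<in>N. \<forall>h\<in>Z'. norm e \<le> norm (e + h)" by (metis insert_iff)
  obtain H where H: "subspace H" "\<And>h. h \<in> H \<Longrightarrow> norm e \<le> norm (e + h)" "\<And>v. \<exists>c. v - c *\<^sub>R e \<in> H"
    using birkhoff_orthogonal_hyperplane[of e] insert.prems by auto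
  show ?case
    using Z' H infinite_dimensional_Int_hyperplane[OF Z'(2) H(1,3)]
    by (intro exI[of _ "Z' \<inter> H"]) auto
qed auto

text \<open>Mazur's lemma. A finite net of the compact unit sphere of \<open>span B\<close> is made orthogonal to an
  infinite-dimensional subspace of \<open>Z\<close>; passing from the sphere to its net costs the factor \<open>q\<close>.\<close>

lemma mazur_step:
  assumes B: "finite B" and q: "q < 1" and Z: "infinite_dimensional_subspace Z"
  shows "\<exists>z\<in>Z. z \<noteq> 0 \<and> (\<forall>e\<in>span B. \<forall>t. q * norm e \<le> norm (e + t *\<^sub>R z))"
proof -
  let ?S = "span B \<inter> sphere 0 1"
  have S_eq: "?S = (span B \<inter> cball 0 1) \<inter> sphere 0 1" by auto
  have S: "compact ?S" unfolding S_eq by (rule compact_Int_closed[OF compact_span_Int_cball[OF B]])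
      (auto simp: sphere_def intro!: closed_Collect_eq continuous_intros)
  obtain N where N: "N \<subseteq> ?S" "finite N" "?S \<subseteq> (\<Union>x\<in>N. ball x (1 - q))"
    by (rule compactE_image[OF S, of ?S "\<lambda>x. ball x (1 - q)"]) (use q in auto)
  have "0 \<notin> N" using N(1) by auto
  then obtain Z' where Z': "Z' \<subseteq> Z" "infinite_dimensional_subspace Z'"
    "\<forall>e\<in>N. \<forall>h\<in>Z'. norm e \<le> norm (e + h)"
    using infinite_dimensional_birkhoff_orthogonal[OF N(2) _ Z] by blast
  have sZ': "subspace Z'" using Z'(2) by (simp add: infinite_dimensional_subspace_def)
  have "Z' \<noteq> {0}" using Z'(2) unfolding infinite_dimensional_subspace_def
    by (metis finite.emptyI span_empty)
  then obtain z where z: "z \<in> Z'" "z \<noteq> 0" using sZ' subspace_0 by blast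
  have unit: "q \<le> norm (e + t *\<^sub>R z)" if "e \<in> span B" "norm e = 1" for e t
  proof -
    obtain f where f: "f \<in> N" "dist f e < 1 - q" using N(3) \<open>e \<in> span B\<close> \<open>norm e = 1\<close> by auto
    have "norm f = 1" using f N(1) by auto
    moreover have "t *\<^sub>R z \<in> Z'" using sZ' z(1) by (rule subspace_scale)
    ultimately have "1 \<le> norm (f + t *\<^sub>R z)" using Z'(3) f(1) by force
    also have "\<dots> \<le> norm (e + t *\<^sub>R z) + norm (f - e)"
      using norm_triangle_ineq[of "e + t *\<^sub>R z" "f - e"] by (simp add: algebra_simps)
    finally show ?thesis using f by (simp add: dist_norm)
  qed
  have "q * norm e \<le> norm (e + t *\<^sub>R z)" if "e \<in> span B" for e t
  proof (cases "e = 0")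
    case False
    then have n: "norm e > 0" by simp
    have "q \<le> norm ((1 / norm e) *\<^sub>R e + (t / norm e) *\<^sub>R z)"
      using that False by (intro unit span_scale) auto
    then have "q * norm e \<le> norm e * norm ((1 / norm e) *\<^sub>R e + (t / norm e) *\<^sub>R z)"
      using n by (simp add: mult.commute)
    also have "\<dots> = norm (norm e *\<^sub>R ((1 / norm e) *\<^sub>R e + (t / norm e) *\<^sub>R z))" by simp
    also have "norm e *\<^sub>R ((1 / norm e) *\<^sub>R e + (t / norm e) *\<^sub>R z) = e + t *\<^sub>R z"
      using n by (simp add: scaleR_add_right)
    finally show ?thesis .
  qed simp
  then show ?thesis using z Z'(1) by blast
qed

lemma Cauchy_if_dist_le:
  fixes v :: "nat \<Rightarrow> 'a::metric_space" and f :: "nat \<Rightarrow> 'b::metric_space"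
  assumes "Cauchy v" and le: "\<And>k l. dist (f k) (f l) \<le> K * dist (v k) (v l)"
  shows "Cauchy f"
proof (rule metric_CauchyI)
  fix e :: real assume "e > 0"
  define K' where "K' = max K 1"
  have K': "K' > 0" by (auto simp: K'_def)
  obtain M where M: "\<And>m n. m \<ge> M \<Longrightarrow> n \<ge> M \<Longrightarrow> dist (v m) (v n) < e / K'"
    using metric_CauchyD[OF assms(1), of "e / K'"] \<open>e > 0\<close> K' by auto
  have "dist (f m) (f n) < e" if "m \<ge> M" "n \<ge> M" for m n
  proof -
    have "dist (f m) (f n) \<le> K' * dist (v m) (v n)"
      using le[of m n] mult_right_mono[of K K' "dist (v m) (v n)"] by (auto simp: K'_def)
    also have "\<dots> < e" using M[OF that] K' by (simp add: field_simps)
    finally show ?thesis .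
  qed
  then show "\<exists>M. \<forall>m\<ge>M. \<forall>n\<ge>M. dist (f m) (f n) < e" by blast
qed

text \<open>Grunblum's criterion. If the partial sum projections on the algebraic span are uniformly
  bounded, so are the coefficient functionals; the coefficients of vectors \<open>u k\<close> tending to \<open>v\<close> therefore
  converge, the projections pass to the limit, and they tend to the identity. Uniqueness holds
  since each partial sum is controlled by the later ones.\<close>

lemma grunblum_unique_expansion:
  fixes y :: "nat \<Rightarrow> 'a::banach"
  assumes nz: "\<And>i. y i \<noteq> 0" and C: "C \<ge> 0"
    and proj: "\<And>a m n. m \<le> n \<Longrightarrow> norm (\<Sum>i<m. a i *\<^sub>R y i) \<le> C * norm (\<Sum>i<n. a i *\<^sub>R y i)"
    and v: "v \<in> closure (span (range y))"
  shows "\<exists>!a. (\<lambda>n. a n *\<^sub>R y n) sums v"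
proof -
  define P where "P a m = (\<Sum>i<m. a i *\<^sub>R y i)" for a m
  have P_diff: "P (\<lambda>i. a i - b i) m = P a m - P b m" for a b m
    by (simp add: P_def scaleR_diff_left sum_subtractf)
  have proj: "norm (P a m) \<le> C * norm (P a n)" if "m \<le> n" for a m n
    unfolding P_def using that by (rule proj)
  obtain u where u: "\<And>k. u k \<in> span (range y)" and uv: "u \<longlonglongrightarrow> v"
    using v unfolding closure_sequential by blast
  have "\<exists>a N. \<forall>m\<ge>N. P a m = u k" for k
  proof -
    obtain N a where a: "u k = (\<Sum>i<N. a i *\<^sub>R y i)"
      using u[of k] unfolding span_range_nat by (auto simp: span_image_finite_iff)
    have "P (\<lambda>i. if i < N then a i else 0) m = u k" if "m \<ge> N" for m
      unfolding P_def a using that by (intro sum.mono_neutral_cong_right) auto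
    then show ?thesis by blast
  qed
  then obtain a N where aN: "\<And>k m. m \<ge> N k \<Longrightarrow> P (a k) m = u k" by metis
  have d1: "norm (P (a k) m - P (a l) m) \<le> C * norm (u k - u l)" for k l m
    using proj[of m "max m (max (N k) (N l))" "\<lambda>i. a k i - a l i"]
    by (simp add: P_diff aN)
  have d2: "dist (a k i) (a l i) \<le> (2 * C / norm (y i)) * dist (u k) (u l)" for i k l
  proof -
    have "(a k i - a l i) *\<^sub>R y i = (P (a k) (Suc i) - P (a l) (Suc i)) - (P (a k) i - P (a l) i)"
      by (simp add: P_def scaleR_diff_left)
    then have "\<bar>a k i - a l i\<bar> * norm (y i) \<le> norm (P (a k) (Suc i) - P (a l) (Suc i)) + norm (P (a k) i - P (a l) i)"
      by (metis norm_scaleR norm_triangle_ineq4)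
    also have "\<dots> \<le> 2 * C * norm (u k - u l)" using d1[of k "Suc i" l] d1[of k i l] by simp
    finally show ?thesis using nz[of i] by (simp add: dist_norm field_simps)
  qed
  have "Cauchy u" using uv by (rule LIMSEQ_imp_Cauchy)
  then have "Cauchy (\<lambda>k. a k i)" for i using d2 by (rule Cauchy_if_dist_le)
  then have "\<exists>b. (\<lambda>k. a k i) \<longlonglongrightarrow> b" for i using Cauchy_convergent convergent_def by blast
  then obtain b where b: "\<And>i. (\<lambda>k. a k i) \<longlonglongrightarrow> b i" by metis
  have Pb: "(\<lambda>k. P (a k) m) \<longlonglongrightarrow> P b m" for m
    unfolding P_def by (intro tendsto_sum tendsto_scaleR b tendsto_const)
  have d3: "norm (P (a k) m - P b m) \<le> C * norm (u k - v)" for k m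
    by (rule LIMSEQ_le[of "\<lambda>l. norm (P (a k) m - P (a l) m)" _ "\<lambda>l. C * norm (u k - u l)"])
      (auto intro!: tendsto_intros Pb uv d1)
  have "(\<lambda>m. P b m) \<longlonglongrightarrow> v"
  proof (rule metric_LIMSEQ_I)
    fix \<epsilon> :: real assume "\<epsilon> > 0"
    then obtain k where k: "dist (u k) v < \<epsilon> / (C + 1)"
      using metric_LIMSEQ_D[OF uv, of "\<epsilon> / (C + 1)"] C by auto
    have "dist (P b m) v < \<epsilon>" if "m \<ge> N k" for m
    proof -
      have "dist (P b m) v \<le> dist (P (a k) m) (P b m) + dist (P (a k) m) v"
        by (rule dist_triangle3)
      also have "\<dots> \<le> C * dist (u k) v + dist (u k) v"
        using d3[of k m] aN[OF that] by (simp add: dist_norm)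
      also have "\<dots> = (C + 1) * dist (u k) v" by (simp add: algebra_simps)
      also have "\<dots> < \<epsilon>" using k C by (simp add: field_simps)
      finally show ?thesis .
    qed
    then show "\<exists>no. \<forall>n\<ge>no. dist (P b n) v < \<epsilon>" by blast
  qed
  then have ex: "(\<lambda>n. b n *\<^sub>R y n) sums v" by (simp add: sums_def P_def)
  show ?thesis
  proof (rule ex1I[of _ b])
    fix b' assume b': "(\<lambda>n. b' n *\<^sub>R y n) sums v"
    have lim: "(\<lambda>n. P (\<lambda>i. b' i - b i) n) \<longlonglongrightarrow> 0"
      using tendsto_diff[OF b'[unfolded sums_def] ex[unfolded sums_def]]
      by (simp add: P_diff) (simp add: P_def)
    have "P (\<lambda>i. b' i - b i) m = 0" for m
    proof -
      have "norm (P (\<lambda>i. b' i - b i) m) \<le> C * norm (0 :: 'a)"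
        using lim by (intro LIMSEQ_le_const[of "\<lambda>n. C * norm (P (\<lambda>i. b' i - b i) n)"] tendsto_intros)
          (auto intro!: exI[of _ m] proj)
      then show ?thesis by simp
    qed
    then have "(b' i - b i) *\<^sub>R y i = 0" for i
      using sum.lessThan_Suc[of "\<lambda>i. (b' i - b i) *\<^sub>R y i" i] unfolding P_def by auto
    then show "b' = b" using nz by (auto simp: fun_eq_iff)
  qed (fact ex)
qed

text \<open>Mazur's construction: the \<open>n\<close>-th vector is chosen almost orthogonal to the previous ones. The
  factors \<open>g (n + 1) / g n\<close> are below \<open>1\<close>, and their products telescope and stay above \<open>1 / 2\<close>, so the
  partial sum projections have norm at most \<open>2\<close>.\<close>

lemma basic_sequence_in_subspace:
  fixes Z :: "'a::banach set"
  assumes Z: "infinite_dimensional_subspace Z"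
  obtains x where "basic_sequence x" "\<And>n. x n \<in> Z"
proof -
  define g where "g n = 1 + 1 / (real n + 1)" for n
  have g: "1 \<le> g n" "g n \<le> 2" "g (Suc n) < g n" for n
    by (auto simp: g_def field_simps)
  define Q where "Q f n r \<longleftrightarrow> r \<in> Z \<and> r \<noteq> 0 \<and>
      (\<forall>e\<in>span (f ` {..<n}). \<forall>t. g (Suc n) / g n * norm e \<le> norm (e + t *\<^sub>R r))"
    for f :: "nat \<Rightarrow> 'a" and n r
  have "\<exists>f. \<forall>n. Q f n (f n)"
  proof (rule dependent_wellorder_choice)
    show "Q f n r = Q f' n r" if "\<And>y. y < n \<Longrightarrow> f y = f' y" for r f f' n
    proof -
      have "f ` {..<n} = f' ` {..<n}" using that by (auto simp: image_iff)
      then show ?thesis by (simp add: Q_def)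
    qed
    show "\<exists>r. Q f n r" for n f
    proof -
      have "g (Suc n) / g n < 1" using g[of n] by simp
      then show ?thesis using mazur_step[of "f ` {..<n}" "g (Suc n) / g n" Z] Z
        unfolding Q_def by auto
    qed
  qed
  then obtain z where z: "\<And>n. Q z n (z n)" by blast
  have one: "norm (\<Sum>i<n. a i *\<^sub>R z i) * g (Suc n) \<le> g n * norm (\<Sum>i<Suc n. a i *\<^sub>R z i)" for a n
  proof -
    have "(\<Sum>i<n. a i *\<^sub>R z i) \<in> span (z ` {..<n})" by (intro span_sum span_scale span_base) auto
    then have "g (Suc n) / g n * norm (\<Sum>i<n. a i *\<^sub>R z i) \<le> norm ((\<Sum>i<n. a i *\<^sub>R z i) + a n *\<^sub>R z n)"
      using z[of n] unfolding Q_def by blast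
    then show ?thesis using g(1)[of n] by (simp add: field_simps)
  qed
  have many: "norm (\<Sum>i<m. a i *\<^sub>R z i) * g n \<le> g m * norm (\<Sum>i<n. a i *\<^sub>R z i)" if "m \<le> n" for a m n
    using that
  proof (induction rule: dec_induct)
    case (step n)
    let ?p = "\<lambda>n. norm (\<Sum>i<n. a i *\<^sub>R z i)"
    have "(?p m * g n) * g (Suc n) \<le> (g m * ?p n) * g (Suc n)"
      using step.IH g(1)[of "Suc n"] by (intro mult_right_mono) auto
    also have "\<dots> \<le> g m * (g n * ?p (Suc n))"
      using mult_left_mono[OF one, of "g m" a n]
        g(1)[of m] by (simp add: mult.assoc)
    finally have "g n * (?p m * g (Suc n)) \<le> g n * (g m * ?p (Suc n))" by (simp add: mult_ac)
    then show ?case using g(1)[of n] by (simp add: mult_le_cancel_left_pos)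
  qed (simp add: mult.commute)
  have proj: "norm (\<Sum>i<m. a i *\<^sub>R z i) \<le> 2 * norm (\<Sum>i<n. a i *\<^sub>R z i)" if "m \<le> n" for a m n
  proof -
    let ?p = "\<lambda>n. norm (\<Sum>i<n. a i *\<^sub>R z i)"
    have "?p m * 1 \<le> ?p m * g n" using g(1) by (intro mult_left_mono) auto
    also have "\<dots> \<le> g m * ?p n" using that by (rule many)
    also have "\<dots> \<le> 2 * ?p n" using g(2) by (intro mult_right_mono) auto
    finally show ?thesis by simp
  qed
  define x where "x n = z (n - 1)" for n
  have rng: "x ` {1..} = range z"
    by (force simp: x_def image_iff intro: bexI[of _ "Suc _"])
  have "basic_sequence x"
    unfolding basic_sequence_def closed_span_def rng
    using grunblum_unique_expansion[of z 2] proj z by (auto simp: x_def Q_def)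
  then show ?thesis using that[of x] z by (auto simp: x_def Q_def)
qed


section \<open>Separated sequences and their spans\<close>

text \<open>Linear independence is not preserved under limits, but having distance at least \<open>1\<close> from the
  span of the previous vectors is. Any linearly independent sequence attains this after
  scaling its vectors, which leaves the spans unchanged.\<close>

definition separated :: "nat \<Rightarrow> (nat \<Rightarrow> 'a::real_normed_vector) \<Rightarrow> bool" where
  "separated n s \<longleftrightarrow> (\<forall>j<n. \<forall>w\<in>span (s ` {..<j}). 1 \<le> norm (s j - w))"

lemma separated_0 [simp]: "separated 0 s"
  by (simp add: separated_def)

lemma separated_Suc:
  "separated (Suc n) s \<longleftrightarrow> separated n s \<and> (\<forall>w\<in>span (s ` {..<n}). 1 \<le> norm (s n - w))"
  by (auto simp: separated_def less_Suc_eq)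

lemma separated_cong: "(\<And>i. i < n \<Longrightarrow> s i = t i) \<Longrightarrow> separated n s \<longleftrightarrow> separated n t"
proof (induction n)
  case (Suc n)
  then have "s ` {..<n} = t ` {..<n}" by (intro image_cong) auto
  then show ?case using Suc by (simp add: separated_Suc)
qed simp

lemma infinite_dimensional_span_separated:
  assumes sep: "\<And>n. separated n s"
  shows "infinite_dimensional_subspace (span (range s))"
  unfolding infinite_dimensional_subspace_def
proof (intro conjI notI)
  have notin: "s n \<notin> span (s ` {..<n})" for n
    using sep[of "Suc n"] by (fastforce simp: separated_Suc)
  have indep: "independent (s ` {..<n}) \<and> card (s ` {..<n}) = n" for n
  proof (induction n)
    case (Suc n)
    have "s n \<notin> s ` {..<n}" using notin[of n] span_base[of "s n" "s ` {..<n}"] by blast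
    then show ?case using Suc notin[of n] by (simp add: lessThan_Suc independent_insert)
  qed (simp add: independent_empty)
  assume "\<exists>B. finite B \<and> span B = span (range s)"
  then obtain B where B: "finite B" "span B = span (range s)" by blast
  have "s ` {..<Suc (card B)} \<subseteq> span B" unfolding B(2) by (auto intro: span_base)
  then have "card (s ` {..<Suc (card B)}) \<le> card B"
    using independent_span_bound[OF B(1) conjunct1[OF indep]] by simp
  then show False using indep[of "Suc (card B)"] by simp
qed simp

lemma span_pointwise_limit:
  fixes s :: "nat \<Rightarrow> 'a::real_normed_vector"
  assumes lim: "\<And>i. i < n \<Longrightarrow> (\<lambda>k. f k i) \<longlonglongrightarrow> s i" and v: "v \<in> span (s ` {..<n})"
  obtains u where "\<And>k. u k \<in> span (f k ` {..<n})" "u \<longlonglongrightarrow> v"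
proof -
  obtain a where a: "v = (\<Sum>i<n. a i *\<^sub>R s i)" using v by (auto simp: span_image_finite_iff)
  have "(\<lambda>k. \<Sum>i<n. a i *\<^sub>R f k i) \<longlonglongrightarrow> v"
    unfolding a by (intro tendsto_sum tendsto_scaleR tendsto_const lim) simp
  moreover have "(\<Sum>i<n. a i *\<^sub>R f k i) \<in> span (f k ` {..<n})" for k
    by (auto simp: span_image_finite_iff)
  ultimately show ?thesis by (intro that)
qed

lemma separated_pointwise_limit:
  assumes sep: "\<And>k. separated n (f k)" and lim: "\<And>i. i < n \<Longrightarrow> (\<lambda>k. f k i) \<longlonglongrightarrow> s i"
  shows "separated n s"
  unfolding separated_def
proof (intro allI impI ballI)
  fix j w assume j: "j < n" and w: "w \<in> span (s ` {..<j})"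
  have "(\<lambda>k. f k i) \<longlonglongrightarrow> s i" if "i < j" for i using lim that j by simp
  from this w obtain u where u: "\<And>k. u k \<in> span (f k ` {..<j})" "u \<longlonglongrightarrow> w"
    by (rule span_pointwise_limit) blast+
  have "(\<lambda>k. norm (f k j - u k)) \<longlonglongrightarrow> norm (s j - w)" by (intro tendsto_intros lim j u)
  then show "1 \<le> norm (s j - w)"
    by (rule LIMSEQ_le_const) (use sep u(1) j in \<open>auto simp: separated_def\<close>)
qed

text \<open>Otherwise \<open>x n\<close> would have two expansions: the trivial one and one supported on \<open>F\<close>.\<close>

lemma basic_sequence_not_in_span:
  assumes x: "basic_sequence x" and F: "finite F" "0 \<notin> F" and n: "n \<ge> 1" "n \<notin> F"
  shows "x n \<notin> span (x ` F)"
proof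
  assume "x n \<in> span (x ` F)"
  then obtain u where u: "x n = (\<Sum>i\<in>F. u i *\<^sub>R x i)" using F(1) by (auto simp: span_image_finite_iff)
  define a where "a m = (if Suc m = n then 1 else 0 :: real)" for m
  define b where "b m = (if Suc m \<in> F then u (Suc m) else 0 :: real)" for m
  have "x n \<in> closed_span (x ` {1..})"
    unfolding closed_span_def using n(1) span_base closure_subset by (metis atLeast_iff imageI subsetD)
  then have unique: "\<exists>!a. (\<lambda>m. a m *\<^sub>R x (Suc m)) sums x n"
    using x unfolding basic_sequence_def by blast
  have "(\<lambda>m. a m *\<^sub>R x (Suc m)) sums (\<Sum>m\<in>{n - 1}. a m *\<^sub>R x (Suc m))"
    by (rule sums_finite) (use n in \<open>auto simp: a_def\<close>)
  then have "(\<lambda>m. a m *\<^sub>R x (Suc m)) sums x n" using n by (simp add: a_def)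
  moreover have "(\<lambda>m. b m *\<^sub>R x (Suc m)) sums x n"
  proof -
    have inj: "inj_on (\<lambda>i. i - 1) F" using F(2) by (intro inj_onI) (metis Suc_pred' not_gr0 One_nat_def)
    have "(\<lambda>m. b m *\<^sub>R x (Suc m)) sums (\<Sum>m\<in>(\<lambda>i. i - 1) ` F. b m *\<^sub>R x (Suc m))"
    proof (rule sums_finite)
      show "b m *\<^sub>R x (Suc m) = 0" if "m \<notin> (\<lambda>i. i - 1) ` F" for m
      proof -
        have "Suc m \<notin> F" using that by (metis diff_Suc_1 imageI)
        then show ?thesis by (simp add: b_def)
      qed
    qed (simp add: F)
    also have "(\<Sum>m\<in>(\<lambda>i. i - 1) ` F. b m *\<^sub>R x (Suc m)) = (\<Sum>i\<in>F. u i *\<^sub>R x i)"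
      unfolding sum.reindex[OF inj]
    proof (rule sum.cong)
      fix i assume i: "i \<in> F"
      then have "Suc (i - 1) = i" using F(2) by (cases i) auto
      then show "((\<lambda>m. b m *\<^sub>R x (Suc m)) \<circ> (\<lambda>i. i - 1)) i = u i *\<^sub>R x i" using i by (simp add: b_def)
    qed simp
    finally show ?thesis by (simp add: u)
  qed
  ultimately have "a = b" using unique by blast
  then have "a (n - 1) = b (n - 1)" by simp
  then show False using n by (simp add: a_def b_def)
qed

lemma infinite_dimensional_separated_vector:
  assumes Y: "infinite_dimensional_subspace Y" and B: "finite B" "B \<subseteq> Y"
  obtains y where "y \<in> Y" "\<And>w. w \<in> span B \<Longrightarrow> 1 \<le> norm (y - w)"
proof -
  have sY: "subspace Y" and "span B \<noteq> Y" using Y B(1) by (auto simp: infinite_dimensional_subspace_def)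
  then obtain y where y: "y \<in> Y" "y \<notin> span B" using span_minimal[OF B(2) sY] by blast
  then obtain c where "\<And>w. w \<in> span B \<Longrightarrow> 1 \<le> norm (c *\<^sub>R y - w)"
    using scale_away_from_span[OF B(1)] by metis
  then show ?thesis using that[of "c *\<^sub>R y"] y sY subspace_scale by blast
qed

lemma basic_sequence_separated_vector:
  assumes "basic_sequence x" "finite F" "0 \<notin> F" "n \<ge> 1" "n \<notin> F"
  obtains c where "\<And>w. w \<in> span (x ` F) \<Longrightarrow> 1 \<le> norm (c *\<^sub>R x n - w)"
  using scale_away_from_span[OF _ basic_sequence_not_in_span[OF assms]] assms(2)
  by (metis finite_imageI)

lemma separated_fun_upd:
  assumes "separated n s" "\<And>w. w \<in> span (s ` {..<n}) \<Longrightarrow> 1 \<le> norm (v - w)"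
  shows "separated (Suc n) (s(n := v))"
proof -
  have "(s(n := v)) ` {..<n} = s ` {..<n}" by (intro image_cong) auto
  moreover have "separated n (s(n := v))"
    using assms(1) by (subst separated_cong[of n _ s]) auto
  ultimately show ?thesis using assms(2) by (simp add: separated_Suc)
qed

text \<open>A tree that can follow the members of \<open>\<S>\<^sub>\<xi>\<close> point by point inherits their rank. The relation
  \<open>rel F n s\<close> is the invariant kept along the way: \<open>s\<close> is a node of length \<open>n\<close> built from \<open>F\<close>.\<close>

lemma rank_tree_of_schreier:
  assumes fs: "fundamental_system fs" and root: "rel {} 0 s"
    and ext: "\<And>F n s m. rel F n s \<Longrightarrow> \<forall>k\<in>F. k < m \<Longrightarrow> m \<ge> 1 \<Longrightarrow> insert m F \<in> schreier fs \<xi> \<Longrightarrow>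
      \<exists>v. rel (insert m F) (Suc n) (s(n := v)) \<and> T (Suc n) (s(n := v))"
  shows "rank_ge (tree_step T) \<xi> (0, s)"
proof (rule rank_ge_simulation[where rel = "\<lambda>F (n, s). rel F n s"])
  show "rank_ge (family_step {F \<in> schreier fs \<xi>. \<forall>k\<in>F. 1 \<le> k}) \<xi> {}"
    using fs by (rule rank_schreier)
  show "case (0, s) of (n, s) \<Rightarrow> rel {} n s" using root by simp
  fix F F' and p :: "nat \<times> (nat \<Rightarrow> 'a)"
  assume rel: "case p of (n, s) \<Rightarrow> rel F n s"
    and step: "family_step {F \<in> schreier fs \<xi>. \<forall>k\<in>F. 1 \<le> k} F F'"
  obtain n s where p: "p = (n, s)" by fastforce
  obtain m where m: "\<forall>k\<in>F. k < m" "m \<ge> 1" "F' = insert m F" "F' \<in> schreier fs \<xi>"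
    using step by (auto simp: family_step_def)
  obtain v where v: "rel F' (Suc n) (s(n := v))" "T (Suc n) (s(n := v))"
    using ext[of F n s m] rel m p by auto
  then have "tree_step T p (Suc n, s(n := v))" by (simp add: tree_step_def p)
  then show "\<exists>p'. tree_step T p p' \<and> (case p' of (n, s) \<Rightarrow> rel F' n s)"
    using v(1) by (intro exI[of _ "(Suc n, s(n := v))"]) simp
qed

lemma separable_space_dense:
  assumes "separable_space (euclidean :: 'a::topological_space topology)"
  obtains D :: "'a::topological_space set" where "countable D" "closure D = UNIV"
  using assms by (auto simp: separable_space_def)


section \<open>Strictly singular operators\<close>

text \<open>An infinite branch spans an infinite-dimensional subspace on which \<open>S\<close> is bounded below.\<close>

definition bounded_below_node ::
    "('a::banach \<Rightarrow>\<^sub>L 'b::banach) \<Rightarrow> real \<Rightarrow> nat \<Rightarrow> (nat \<Rightarrow> 'a) \<Rightarrow> bool" where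
  "bounded_below_node S \<epsilon> n s \<longleftrightarrow>
    separated n s \<and> (\<forall>z\<in>span (s ` {..<n}). \<epsilon> * norm z \<le> norm (blinfun_apply S z))"

lemma bounded_below_node_closed:
  assumes node: "\<And>k. bounded_below_node S \<epsilon> n (f k)" and lim: "\<And>i. i < n \<Longrightarrow> (\<lambda>k. f k i) \<longlonglongrightarrow> s i"
  shows "bounded_below_node S \<epsilon> n s"
  unfolding bounded_below_node_def
proof (intro conjI ballI)
  show "separated n s"
    using separated_pointwise_limit lim node unfolding bounded_below_node_def by blast
  fix z assume "z \<in> span (s ` {..<n})"
  with lim obtain u where u: "\<And>k. u k \<in> span (f k ` {..<n})" "u \<longlonglongrightarrow> z"
    by (rule span_pointwise_limit) blast+
  show "\<epsilon> * norm z \<le> norm (blinfun_apply S z)"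
    by (rule LIMSEQ_le[of "\<lambda>k. \<epsilon> * norm (u k)" _ "\<lambda>k. norm (blinfun_apply S (u k))"])
      (use u node in \<open>auto intro!: tendsto_intros simp: bounded_below_node_def\<close>)
qed

text \<open>A basic sequence \<open>x\<close> that witnesses the failure gives nodes of the tree: each \<open>F\<close> in the Schreier
  family yields suitable multiples of the vectors \<open>x i\<close> for \<open>i\<close> in \<open>F\<close>. The constant is weakened to the
  reciprocal of an integer, so that only countably many trees occur.\<close>

lemma not_schreier_strictly_singular_rank:
  fixes S :: "'a::banach \<Rightarrow>\<^sub>L 'b::banach"
  assumes fs: "fundamental_system fs" and S: "\<not> schreier_strictly_singular fs \<xi> S"
  shows "\<exists>N. rank_ge (tree_step (bounded_below_node S (inverse (real (Suc N))))) \<xi> (0, \<lambda>_. 0)"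
proof -
  obtain \<epsilon> x where \<epsilon>: "\<epsilon> > 0" and x: "basic_sequence x"
    and big: "\<And>F z. F \<in> schreier fs \<xi> \<Longrightarrow> z \<in> closed_span (x ` F) - {0} \<Longrightarrow>
        \<epsilon> * norm z < norm (blinfun_apply S z)"
    using S unfolding schreier_strictly_singular_def by (meson not_le)
  obtain N where N: "inverse (real (Suc N)) < \<epsilon>" using reals_Archimedean[OF \<epsilon>] by blast
  have below: "inverse (real (Suc N)) * norm z \<le> norm (blinfun_apply S z)"
    if F: "F \<in> schreier fs \<xi>" and z: "z \<in> span (x ` F)" for F z
  proof (cases "z = 0")
    case False
    have "z \<in> closed_span (x ` F)" unfolding closed_span_def using z closure_subset by blast
    then have "\<epsilon> * norm z < norm (blinfun_apply S z)" using big F False by blast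
    then show ?thesis using mult_right_mono[of _ \<epsilon> "norm z"] N by (smt (verit) norm_ge_zero)
  qed simp
  show ?thesis
  proof (rule exI[of _ N], rule rank_tree_of_schreier[where rel = "\<lambda>F n s. finite F \<and> 0 \<notin> F \<and>
        s ` {..<n} \<subseteq> span (x ` F) \<and> separated n s", OF fs])
    fix F n m and s :: "nat \<Rightarrow> 'a"
    assume rel: "finite F \<and> 0 \<notin> F \<and> s ` {..<n} \<subseteq> span (x ` F) \<and> separated n s"
      and m: "\<forall>k\<in>F. k < m" "m \<ge> 1" and F': "insert m F \<in> schreier fs \<xi>"
    then obtain c where c: "\<And>w. w \<in> span (x ` F) \<Longrightarrow> 1 \<le> norm (c *\<^sub>R x m - w)"
      using basic_sequence_separated_vector[OF x, of F m] by blast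
    let ?s = "s(n := c *\<^sub>R x m)"
    have "span (s ` {..<n}) \<subseteq> span (x ` F)" using rel by (intro span_minimal) auto
    then have sep: "separated (Suc n) ?s" using rel c by (intro separated_fun_upd) auto
    have "span (x ` F) \<subseteq> span (x ` insert m F)" by (intro span_mono) auto
    moreover have "c *\<^sub>R x m \<in> span (x ` insert m F)" by (intro span_scale span_base) auto
    ultimately have sub: "?s ` {..<Suc n} \<subseteq> span (x ` insert m F)"
      using rel by (auto simp: less_Suc_eq image_subset_iff)
    then have "span (?s ` {..<Suc n}) \<subseteq> span (x ` insert m F)" by (intro span_minimal) auto
    then have "bounded_below_node S (inverse (real (Suc N))) (Suc n) ?s"
      unfolding bounded_below_node_def using sep below[OF F'] by blast
    then show "\<exists>v. (finite (insert m F) \<and> 0 \<notin> insert m F \<and>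
        (s(n := v)) ` {..<Suc n} \<subseteq> span (x ` insert m F) \<and> separated (Suc n) (s(n := v))) \<and>
        bounded_below_node S (inverse (real (Suc N))) (Suc n) (s(n := v))"
      using rel m sep sub by (intro exI[of _ "c *\<^sub>R x m"]) auto
  qed simp
qed

text \<open>If \<open>S\<close> fails to be \<open>\<S>\<^sub>\<xi>\<close>-strictly singular for every \<open>\<xi>\<close>, then one of the countably many trees has
  rank at least \<open>\<xi>\<close> for all \<open>\<xi>\<close>, and its branch contradicts strict singularity.\<close>

lemma strictly_singular_imp_schreier:
  fixes S :: "'a::banach \<Rightarrow>\<^sub>L 'b::banach"
  assumes fs: "fundamental_system fs" and sep: "separable_space (euclidean :: 'a topology)"
    and S: "strictly_singular S"
  shows "\<exists>\<xi>\<ge>1. schreier_strictly_singular fs \<xi> S"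
proof (rule ccontr)
  assume neg: "\<not> (\<exists>\<xi>\<ge>1. schreier_strictly_singular fs \<xi> S)"
  let ?T = "\<lambda>N. bounded_below_node S (inverse (real (Suc N)))"
  have "\<exists>N. \<forall>\<xi>. rank_ge (tree_step (?T N)) \<xi> (0, \<lambda>_. 0)"
  proof (rule omega1_uniform_choice)
    fix \<xi>
    have "\<not> schreier_strictly_singular fs (max 1 \<xi>) S" using neg by (meson max.cobounded1)
    then obtain N where "rank_ge (tree_step (?T N)) (max 1 \<xi>) (0, \<lambda>_. 0)"
      using not_schreier_strictly_singular_rank[OF fs] by blast
    then have "rank_ge (tree_step (?T N)) \<xi> (0, \<lambda>_. 0)" by (rule rank_ge_antimono) simp
    then show "\<exists>N. rank_ge (tree_step (?T N)) \<xi> (0, \<lambda>_. 0)" by blast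
  qed (rule rank_ge_antimono)
  then obtain N where rank: "\<And>\<xi>. rank_ge (tree_step (?T N)) \<xi> (0, \<lambda>_. 0)" by blast
  obtain D :: "'a set" where D: "countable D" "closure D = UNIV"
    using separable_space_dense[OF sep] .
  have "\<exists>s. \<forall>n. ?T N n s"
  proof (rule closed_tree_of_rank_omega1_has_branch[OF D _ _ _ rank])
    show "?T N n s" if "\<And>k. ?T N n (f k)" "\<And>i. i < n \<Longrightarrow> (\<lambda>k. f k i) \<longlonglongrightarrow> s i" for n f s
      using that by (rule bounded_below_node_closed)
    show "?T N n s" if "?T N (Suc n) s" for n s
    proof -
      have "span (s ` {..<n}) \<subseteq> span (s ` {..<Suc n})" by (intro span_mono image_mono) auto
      then show ?thesis using that unfolding bounded_below_node_def separated_Suc by blast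
    qed
    show "?T N 0 (\<lambda>_. 0)" by (simp add: bounded_below_node_def)
  qed
  then obtain s where s: "\<And>n. ?T N n s" by blast
  define \<epsilon> where "\<epsilon> = inverse (real (Suc N))"
  have \<epsilon>: "\<epsilon> > 0" by (simp add: \<epsilon>_def)
  let ?Z = "span (range s)"
  have below: "\<epsilon> * norm z \<le> norm (blinfun_apply S z)" if "z \<in> ?Z" for z
    using that s unfolding span_range_nat bounded_below_node_def \<epsilon>_def by blast
  have inj: "inj_on (blinfun_apply S) ?Z"
  proof (rule inj_onI)
    fix z w assume "z \<in> ?Z" "w \<in> ?Z" "blinfun_apply S z = blinfun_apply S w"
    then have "\<epsilon> * norm (z - w) \<le> 0"
      using below[of "z - w"] by (simp add: span_diff blinfun.diff_right)
    then show "z = w" using \<epsilon> by (simp add: mult_le_0_iff)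
  qed
  moreover have "norm (inv_into ?Z (blinfun_apply S) w) \<le> 1/\<epsilon> * norm w" if w: "w \<in> blinfun_apply S ` ?Z" for w
  proof -
    obtain z where z: "z \<in> ?Z" "w = blinfun_apply S z" using w by blast
    then show ?thesis using below[OF z(1)] inj \<epsilon> by (simp add: field_simps)
  qed
  ultimately have "isomorphism_onto_image_on S ?Z"
    unfolding isomorphism_onto_image_on_def by blast
  moreover have "infinite_dimensional_subspace ?Z"
    using s by (intro infinite_dimensional_span_separated) (simp add: bounded_below_node_def)
  ultimately show False using S unfolding strictly_singular_def by blast
qed

text \<open>A lower bound for \<open>S\<close> on an infinite-dimensional subspace would hold on the closed span of
  every part of a basic sequence in that subspace, but \<open>\<S>\<^sub>\<xi>\<close>-strict singularity provides unit
  vectors there whose images under \<open>S\<close> are arbitrarily small.\<close>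

lemma schreier_imp_strictly_singular:
  fixes S :: "'a::banach \<Rightarrow>\<^sub>L 'b::banach"
  assumes S: "schreier_strictly_singular fs \<xi> S"
  shows "strictly_singular S"
  unfolding strictly_singular_def
proof (intro allI impI notI)
  fix Z :: "'a set"
  assume Z: "infinite_dimensional_subspace Z" and iso: "isomorphism_onto_image_on S Z"
  obtain K0 where inj: "inj_on (blinfun_apply S) Z"
    and K0: "\<And>w. w \<in> blinfun_apply S ` Z \<Longrightarrow> norm (inv_into Z (blinfun_apply S) w) \<le> K0 * norm w"
    using iso unfolding isomorphism_onto_image_on_def by blast
  define K where "K = max K0 1"
  have K: "K > 0" by (simp add: K_def)
  have below: "norm z \<le> K * norm (blinfun_apply S z)" if "z \<in> Z" for z
    using K0[of "blinfun_apply S z"] that inj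
      mult_right_mono[of K0 K "norm (blinfun_apply S z)"] by (simp add: K_def)
  obtain x where x: "basic_sequence x" "\<And>n. x n \<in> Z" using basic_sequence_in_subspace[OF Z] by blast
  have "1 / (2 * K) > 0" using K by simp
  then obtain F z where z: "z \<in> closed_span (x ` F)" "z \<noteq> 0"
    "norm (blinfun_apply S z) \<le> 1 / (2 * K) * norm z"
    using S x(1) unfolding schreier_strictly_singular_def by blast
  have "closed {z. norm z \<le> K * norm (blinfun_apply S z)}"
    by (intro closed_Collect_le continuous_intros linear_continuous_on blinfun.bounded_linear_right)
  moreover have "span (x ` F) \<subseteq> Z"
    using Z x(2) by (intro span_minimal) (auto simp: infinite_dimensional_subspace_def)
  ultimately have "closed_span (x ` F) \<subseteq> {z. norm z \<le> K * norm (blinfun_apply S z)}"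
    unfolding closed_span_def using below by (intro closure_minimal) auto
  then have "norm z \<le> K * norm (blinfun_apply S z)" using z(1) by blast
  also have "\<dots> \<le> K * (1 / (2 * K) * norm z)" using z(3) K by (intro mult_left_mono) auto
  also have "\<dots> = norm z / 2" using K by simp
  finally show False using z(2) by simp
qed


section \<open>Hereditarily indecomposable spaces\<close>

text \<open>The first components of a branch span a subspace \<open>Y\<close> and the second ones a subspace \<open>Z\<close> such that
  the projection from \<open>Y + Z\<close> to \<open>Y\<close> has norm at most \<open>1 / \<epsilon>\<close>. Choosing both sequences
  simultaneously keeps them in one tree.\<close>

definition far_pair_node :: "real \<Rightarrow> nat \<Rightarrow> (nat \<Rightarrow> 'a::real_normed_vector \<times> 'a) \<Rightarrow> bool" where
  "far_pair_node \<epsilon> n p \<longleftrightarrow> separated n (fst \<circ> p) \<and> separated n (snd \<circ> p) \<and>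
    (\<forall>y\<in>span ((fst \<circ> p) ` {..<n}). \<forall>z\<in>span ((snd \<circ> p) ` {..<n}). \<epsilon> * norm y \<le> norm (y - z))"

lemma far_pair_node_closed:
  assumes node: "\<And>k. far_pair_node \<epsilon> n (f k)" and lim: "\<And>i. i < n \<Longrightarrow> (\<lambda>k. f k i) \<longlonglongrightarrow> p i"
  shows "far_pair_node \<epsilon> n p"
  unfolding far_pair_node_def
proof (intro conjI ballI)
  have lim1: "(\<lambda>k. (fst \<circ> f k) i) \<longlonglongrightarrow> (fst \<circ> p) i" and lim2: "(\<lambda>k. (snd \<circ> f k) i) \<longlonglongrightarrow> (snd \<circ> p) i"
    if "i < n" for i using lim[OF that] by (auto intro: tendsto_fst tendsto_snd)
  have sep: "separated n (fst \<circ> f k)" "separated n (snd \<circ> f k)" for k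
    using node[of k] by (simp_all add: far_pair_node_def)
  show "separated n (fst \<circ> p)" using sep(1) lim1 by (rule separated_pointwise_limit)
  show "separated n (snd \<circ> p)" using sep(2) lim2 by (rule separated_pointwise_limit)
  fix y z assume y: "y \<in> span ((fst \<circ> p) ` {..<n})" and z: "z \<in> span ((snd \<circ> p) ` {..<n})"
  obtain u where u: "\<And>k. u k \<in> span ((fst \<circ> f k) ` {..<n})" "u \<longlonglongrightarrow> y"
    using span_pointwise_limit[of n "\<lambda>k. fst \<circ> f k", OF lim1 y] by blast
  obtain v where v: "\<And>k. v k \<in> span ((snd \<circ> f k) ` {..<n})" "v \<longlonglongrightarrow> z"
    using span_pointwise_limit[of n "\<lambda>k. snd \<circ> f k", OF lim2 z] by blast
  have "\<epsilon> * norm (u k) \<le> norm (u k - v k)" for k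
    using node u(1) v(1) unfolding far_pair_node_def by blast
  moreover have "(\<lambda>k. \<epsilon> * norm (u k)) \<longlonglongrightarrow> \<epsilon> * norm y" "(\<lambda>k. norm (u k - v k)) \<longlonglongrightarrow> norm (y - z)"
    by (intro tendsto_intros u v)+
  ultimately show "\<epsilon> * norm y \<le> norm (y - z)" by (intro LIMSEQ_le) auto
qed

text \<open>The second components are multiples of the vectors \<open>x i\<close> of the bad basic sequence, for \<open>i\<close> in a member of
  the Schreier family; the first components are taken from the bad subspace \<open>Y\<close>, where an
  infinite dimension always leaves room for one more vector.\<close>

lemma not_schreier_HI_rank:
  assumes fs: "fundamental_system fs" and HI: "\<not> schreier_HI fs \<xi> TYPE('a::banach)"
  shows "\<exists>N. rank_ge (tree_step (far_pair_node (inverse (real (Suc N))))) \<xi> (0, \<lambda>_. (0 :: 'a \<times> 'a))"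
proof -
  obtain \<epsilon> Y and x :: "nat \<Rightarrow> 'a" where \<epsilon>: "\<epsilon> > 0" and Y: "infinite_dimensional_subspace Y"
    and x: "basic_sequence x"
    and big: "\<And>F y. F \<in> schreier fs \<xi> \<Longrightarrow> y \<in> Y \<Longrightarrow> norm y = 1 \<Longrightarrow>
        \<epsilon> \<le> infdist y (closed_span (x ` F))"
    using HI unfolding schreier_HI_def by (meson not_le)
  have sY: "subspace Y" using Y by (simp add: infinite_dimensional_subspace_def)
  obtain N where N: "inverse (real (Suc N)) < \<epsilon>" using reals_Archimedean[OF \<epsilon>] by blast
  have far: "inverse (real (Suc N)) * norm y \<le> norm (y - z)"
    if F: "F \<in> schreier fs \<xi>" and y: "y \<in> Y" and z: "z \<in> span (x ` F)" for F y z
  proof (cases "y = 0")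
    case False
    have "(1 / norm y) *\<^sub>R z \<in> closed_span (x ` F)"
      unfolding closed_span_def using span_scale[OF z] closure_subset by blast
    then have "infdist ((1 / norm y) *\<^sub>R y) (closed_span (x ` F))
        \<le> dist ((1 / norm y) *\<^sub>R y) ((1 / norm y) *\<^sub>R z)" by (rule infdist_le)
    moreover have "\<epsilon> \<le> infdist ((1 / norm y) *\<^sub>R y) (closed_span (x ` F))"
      using False y sY by (intro big[OF F]) (auto intro: subspace_scale)
    moreover have "dist ((1 / norm y) *\<^sub>R y) ((1 / norm y) *\<^sub>R z) = norm (y - z) / norm y"
      unfolding dist_norm scaleR_diff_right[symmetric] by simp
    ultimately have "\<epsilon> \<le> norm (y - z) / norm y" by linarith
    then have "\<epsilon> * norm y \<le> norm (y - z)" using False by (simp add: pos_le_divide_eq)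
    then show ?thesis using mult_right_mono[of _ \<epsilon> "norm y"] N by (smt (verit) norm_ge_zero)
  qed simp
  show ?thesis
  proof (rule exI[of _ N], rule rank_tree_of_schreier[where rel = "\<lambda>F n p. finite F \<and> 0 \<notin> F \<and>
        (fst \<circ> p) ` {..<n} \<subseteq> Y \<and> (snd \<circ> p) ` {..<n} \<subseteq> span (x ` F) \<and>
        separated n (fst \<circ> p) \<and> separated n (snd \<circ> p)", OF fs])
    fix F n m and p :: "nat \<Rightarrow> 'a \<times> 'a"
    assume rel: "finite F \<and> 0 \<notin> F \<and> (fst \<circ> p) ` {..<n} \<subseteq> Y \<and> (snd \<circ> p) ` {..<n} \<subseteq> span (x ` F) \<and>
        separated n (fst \<circ> p) \<and> separated n (snd \<circ> p)"
      and m: "\<forall>k\<in>F. k < m" "m \<ge> 1" and F': "insert m F \<in> schreier fs \<xi>"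
    then obtain c where c: "\<And>w. w \<in> span (x ` F) \<Longrightarrow> 1 \<le> norm (c *\<^sub>R x m - w)"
      using basic_sequence_separated_vector[OF x, of F m] by blast
    obtain y where y: "y \<in> Y" "\<And>w. w \<in> span ((fst \<circ> p) ` {..<n}) \<Longrightarrow> 1 \<le> norm (y - w)"
      using infinite_dimensional_separated_vector[OF Y, of "(fst \<circ> p) ` {..<n}"] rel by auto
    let ?p = "p(n := (y, c *\<^sub>R x m))"
    have fst_p: "fst \<circ> ?p = (fst \<circ> p)(n := y)" and snd_p: "snd \<circ> ?p = (snd \<circ> p)(n := c *\<^sub>R x m)"
      by auto
    have sep1: "separated (Suc n) (fst \<circ> ?p)"
      unfolding fst_p using rel y by (intro separated_fun_upd) auto
    have "span ((snd \<circ> p) ` {..<n}) \<subseteq> span (x ` F)" using rel by (intro span_minimal) auto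
    then have sep2: "separated (Suc n) (snd \<circ> ?p)"
      unfolding snd_p using rel c by (intro separated_fun_upd) auto
    have sub1: "(fst \<circ> ?p) ` {..<Suc n} \<subseteq> Y"
      using rel y by (auto simp: less_Suc_eq image_subset_iff)
    have "span (x ` F) \<subseteq> span (x ` insert m F)" by (intro span_mono) auto
    moreover have "c *\<^sub>R x m \<in> span (x ` insert m F)" by (intro span_scale span_base) auto
    ultimately have sub2: "(snd \<circ> ?p) ` {..<Suc n} \<subseteq> span (x ` insert m F)"
      using rel by (auto simp: less_Suc_eq image_subset_iff)
    have "span ((fst \<circ> ?p) ` {..<Suc n}) \<subseteq> Y" using sub1 sY by (rule span_minimal)
    moreover have "span ((snd \<circ> ?p) ` {..<Suc n}) \<subseteq> span (x ` insert m F)"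
      using sub2 by (intro span_minimal) auto
    ultimately have "far_pair_node (inverse (real (Suc N))) (Suc n) ?p"
      unfolding far_pair_node_def using sep1 sep2 far[OF F'] by blast
    then show "\<exists>v. (finite (insert m F) \<and> 0 \<notin> insert m F \<and> (fst \<circ> p(n := v)) ` {..<Suc n} \<subseteq> Y \<and>
        (snd \<circ> p(n := v)) ` {..<Suc n} \<subseteq> span (x ` insert m F) \<and>
        separated (Suc n) (fst \<circ> p(n := v)) \<and> separated (Suc n) (snd \<circ> p(n := v))) \<and>
        far_pair_node (inverse (real (Suc N))) (Suc n) (p(n := v))"
      using rel m sep1 sep2 sub1 sub2 by (intro exI[of _ "(y, c *\<^sub>R x m)"]) simp
  qed simp
qed

text \<open>The spans of the two components of a branch would be subspaces with a bounded projection.\<close>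

lemma HI_imp_schreier_HI:
  assumes fs: "fundamental_system fs" and sep: "separable_space (euclidean :: 'a::banach topology)"
    and HI: "hereditarily_indecomposable TYPE('a)"
  shows "\<exists>\<xi>\<ge>1. schreier_HI fs \<xi> TYPE('a)"
proof (rule ccontr)
  assume neg: "\<not> (\<exists>\<xi>\<ge>1. schreier_HI fs \<xi> TYPE('a))"
  let ?T = "\<lambda>N. far_pair_node (inverse (real (Suc N))) :: nat \<Rightarrow> (nat \<Rightarrow> 'a \<times> 'a) \<Rightarrow> bool"
  have "\<exists>N. \<forall>\<xi>. rank_ge (tree_step (?T N)) \<xi> (0, \<lambda>_. 0)"
  proof (rule omega1_uniform_choice)
    fix \<xi>
    have "\<not> schreier_HI fs (max 1 \<xi>) TYPE('a)" using neg by (meson max.cobounded1)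
    then obtain N where "rank_ge (tree_step (?T N)) (max 1 \<xi>) (0, \<lambda>_. 0)"
      using not_schreier_HI_rank[OF fs] by blast
    then have "rank_ge (tree_step (?T N)) \<xi> (0, \<lambda>_. 0)" by (rule rank_ge_antimono) simp
    then show "\<exists>N. rank_ge (tree_step (?T N)) \<xi> (0, \<lambda>_. 0)" by blast
  qed (rule rank_ge_antimono)
  then obtain N where rank: "\<And>\<xi>. rank_ge (tree_step (?T N)) \<xi> (0, \<lambda>_. 0)" by blast
  obtain D :: "'a set" where D: "countable D" "closure D = UNIV"
    using separable_space_dense[OF sep] .
  have D2: "countable (D \<times> D)" "closure (D \<times> D) = UNIV" using D by (auto simp: closure_Times)
  have "\<exists>p. \<forall>n. ?T N n p"
  proof (rule closed_tree_of_rank_omega1_has_branch[OF D2 _ _ _ rank])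
    show "?T N n p" if "\<And>k. ?T N n (f k)" "\<And>i. i < n \<Longrightarrow> (\<lambda>k. f k i) \<longlonglongrightarrow> p i" for n f p
      using that by (rule far_pair_node_closed)
    show "?T N n p" if "?T N (Suc n) p" for n p
    proof -
      have "span ((fst \<circ> p) ` {..<n}) \<subseteq> span ((fst \<circ> p) ` {..<Suc n})"
        "span ((snd \<circ> p) ` {..<n}) \<subseteq> span ((snd \<circ> p) ` {..<Suc n})"
        by (intro span_mono image_mono; simp)+
      then show ?thesis using that unfolding far_pair_node_def separated_Suc by blast
    qed
    show "?T N 0 (\<lambda>_. 0)" by (simp add: far_pair_node_def)
  qed
  then obtain p where p: "\<And>n. ?T N n p" by blast
  define \<epsilon> where "\<epsilon> = inverse (real (Suc N))"
  have \<epsilon>: "\<epsilon> > 0" by (simp add: \<epsilon>_def)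
  let ?Y = "span (range (fst \<circ> p))" and ?Z = "span (range (snd \<circ> p))"
  have far: "\<epsilon> * norm y \<le> norm (y - z)" if yz: "y \<in> ?Y" "z \<in> ?Z" for y z
  proof -
    obtain k l where k: "y \<in> span ((fst \<circ> p) ` {..<k})" and l: "z \<in> span ((snd \<circ> p) ` {..<l})"
      using yz unfolding span_range_nat by blast
    have "span ((fst \<circ> p) ` {..<k}) \<subseteq> span ((fst \<circ> p) ` {..<max k l})"
      "span ((snd \<circ> p) ` {..<l}) \<subseteq> span ((snd \<circ> p) ` {..<max k l})"
      by (intro span_mono image_mono; simp)+
    then show ?thesis using k l p[of "max k l"] unfolding far_pair_node_def \<epsilon>_def by blast
  qed
  have "infinite_dimensional_subspace ?Y" "infinite_dimensional_subspace ?Z"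
    using p by (intro infinite_dimensional_span_separated; simp add: far_pair_node_def)+
  moreover have "?Y \<inter> ?Z = {0}"
  proof -
    have "v = 0" if "v \<in> ?Y" "v \<in> ?Z" for v using far[OF that] \<epsilon> by (simp add: mult_le_0_iff)
    then show ?thesis using span_zero by blast
  qed
  moreover have "norm y \<le> 1/\<epsilon> * norm (y + z)" if "y \<in> ?Y" "z \<in> ?Z" for y z
    using far[OF that(1) span_neg[OF that(2)]] \<epsilon> by (simp add: field_simps)
  ultimately show False using HI unfolding hereditarily_indecomposable_def by blast
qed

text \<open>If the projection from \<open>Y + Z\<close> to \<open>Y\<close> has norm at most \<open>K\<close>, then unit vectors of \<open>Y\<close> have distance at
  least \<open>1 / K\<close> from \<open>Z\<close>, hence from the closed span of any part of a basic sequence in \<open>Z\<close>.\<close>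

lemma schreier_HI_imp_HI:
  assumes inf: "infinite_dimensional_subspace (UNIV :: 'a::banach set)"
    and HI: "schreier_HI fs \<xi> TYPE('a)"
  shows "hereditarily_indecomposable TYPE('a)"
  unfolding hereditarily_indecomposable_def
proof (intro conjI inf allI impI notI)
  fix Y Z :: "'a set"
  assume Y: "infinite_dimensional_subspace Y" and Z: "infinite_dimensional_subspace Z"
    and "\<exists>K. \<forall>y\<in>Y. \<forall>z\<in>Z. norm y \<le> K * norm (y + z)"
  then obtain K0 where K0: "\<And>y z. y \<in> Y \<Longrightarrow> z \<in> Z \<Longrightarrow> norm y \<le> K0 * norm (y + z)" by blast
  define K where "K = max K0 1"
  have K: "K > 0" by (simp add: K_def)
  have bound: "norm y \<le> K * norm (y + z)" if "y \<in> Y" "z \<in> Z" for y z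
    using K0[OF that] mult_right_mono[of K0 K "norm (y + z)"] by (simp add: K_def)
  have sZ: "subspace Z" using Z by (simp add: infinite_dimensional_subspace_def)
  obtain x where x: "basic_sequence x" "\<And>n. x n \<in> Z" using basic_sequence_in_subspace[OF Z] by blast
  have "1 / K > 0" using K by simp
  then obtain F y where y: "y \<in> Y" "norm y = 1" "infdist y (closed_span (x ` F)) < 1 / K"
    using HI x(1) Y unfolding schreier_HI_def by blast
  have sub: "span (x ` F) \<subseteq> Z" using x(2) sZ by (intro span_minimal) auto
  have "closed {w. 1 \<le> K * dist y w}"
    by (intro closed_Collect_le continuous_intros)
  moreover have "1 \<le> K * dist y w" if "w \<in> span (x ` F)" for w
    using bound[OF y(1), of "- w"] subspace_neg[OF sZ] that sub y(2) by (auto simp: dist_norm)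
  ultimately have "closed_span (x ` F) \<subseteq> {w. 1 \<le> K * dist y w}"
    unfolding closed_span_def by (intro closure_minimal) auto
  then have "1 / K \<le> dist y w" if "w \<in> closed_span (x ` F)" for w
    using that K by (auto simp: field_simps)
  moreover have "closed_span (x ` F) \<noteq> {}"
    unfolding closed_span_def using span_zero[of "x ` F"] by auto
  ultimately have "1 / K \<le> infdist y (closed_span (x ` F))"
    by (simp add: infdist_def cINF_greatest)
  then show False using y(3) by simp
qed


section \<open>The ordinal characterisations\<close>

theorem theorem6p5:
  fixes fs :: "omega1 \<Rightarrow> nat \<Rightarrow> omega1"
    and S :: "'a::banach \<Rightarrow>\<^sub>L 'b::banach"
  assumes "fundamental_system fs"
    and "separable_space (euclidean :: 'a topology)"
    and "separable_space (euclidean :: 'b topology)"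
  shows "(infinite_dimensional_subspace (UNIV :: 'a set) \<longrightarrow>
            (hereditarily_indecomposable TYPE('a) \<longleftrightarrow> (\<exists>\<xi>\<ge>1. schreier_HI fs \<xi> TYPE('a))))
       \<and> (strictly_singular S \<longleftrightarrow> (\<exists>\<xi>\<ge>1. schreier_strictly_singular fs \<xi> S))"
  using HI_imp_schreier_HI[OF assms(1,2)] schreier_HI_imp_HI
    strictly_singular_imp_schreier[OF assms(1,2)] schreier_imp_strictly_singular
  by blast

end
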